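(* Let $C\subset A$ be a regular abelian $\ast$-subalgebra of a C$^\ast$-algebra $A$. Let $\pi\colon A\to\mathbb B(H)$ be a $\ast$-representation such that $\pi(A)''$ is finite. Then $\pi(C)''$ is regular in $\pi(A)''$. In particular, if $\pi(A)''$ is a type II$_1$ factor, then $\pi(C)''$ is either diffuse or finite dimensional.
   Context: Only nonzero subalgebras are considered, and no separability is assumed. $\mathbb B(H)$ is the algebra of bounded operators on a Hilbert space $H$, and $S''$ denotes the double commutant in $\mathbb B(H)$. For a $\ast$-subalgebra $C$ of a C$^\ast$-algebra $A$, the normalizer is $N_A(C)=\{n\in A: nCn^\ast\cup n^\ast Cn\subset C\}$, and $C$ is regular in $A$ if $N_A(C)$ generates $A$ as a C$^\ast$-algebra. For a $\ast$-subalgebra $N$ of a von Neumann algebra $M$, the normalizer is $\mathcal N_M(N)=\{u\in U(M): uNu^\ast=N\}$, where $U(M)$ is the unitary group of $M$, and $N$ is regular in $M$ if $\mathcal N_M(N)''=M$. Regularity of $C$ in $A$ is in the C$^\ast$-sense; regularity of $\pi(C)''$ in $\pi(A)''$ is in the von Neumann algebra sense. A von Neumann algebra is diffuse if it has no minimal projections. *)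

theory Defs
  imports "HOL-Analysis.Analysis"
begin

section \<open>Complex vector spaces, C*-algebras and Hilbert spaces\<close>

class complex_vector = real_vector +
  fixes scaleC :: "complex \<Rightarrow> 'a \<Rightarrow> 'a" (infixr \<open>*\<^sub>C\<close> 75)
  assumes scaleC_add_right: "c *\<^sub>C (x + y) = c *\<^sub>C x + c *\<^sub>C y"
    and scaleC_add_left: "(c + d) *\<^sub>C x = c *\<^sub>C x + d *\<^sub>C x"
    and scaleC_scaleC: "c *\<^sub>C d *\<^sub>C x = (c * d) *\<^sub>C x"
    and scaleC_one: "1 *\<^sub>C x = x"
    and scaleR_scaleC: "r *\<^sub>R x = complex_of_real r *\<^sub>C x"

global_interpretation complex_vector: vector_space "scaleC :: complex \<Rightarrow> 'a \<Rightarrow> 'a::complex_vector"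
  by unfold_locales (simp_all add: scaleC_add_right scaleC_add_left scaleC_scaleC scaleC_one)

class complex_normed_vector = complex_vector + real_normed_vector +
  assumes norm_scaleC: "norm (c *\<^sub>C x) = cmod c * norm x"

text \<open>C*-algebras are not assumed to be unital.\<close>

class cstar_algebra = complex_normed_vector + real_normed_algebra + banach +
  fixes star :: "'a \<Rightarrow> 'a"
  assumes mult_scaleC_left: "(c *\<^sub>C x) * y = c *\<^sub>C (x * y)"
    and mult_scaleC_right: "x * (c *\<^sub>C y) = c *\<^sub>C (x * y)"
    and star_add: "star (x + y) = star x + star y"
    and star_scaleC: "star (c *\<^sub>C x) = cnj c *\<^sub>C star x"
    and star_mult: "star (x * y) = star y * star x"
    and star_star: "star (star x) = x"
    and norm_star_mult: "norm (star x * x) = (norm x)\<^sup>2"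

text \<open>The inner product is linear in the first argument. Its real part is the inner product of the
  underlying real space, so that the norm is the one induced by \<^const>\<open>inner\<close>.\<close>

class complex_inner = complex_normed_vector + real_inner +
  fixes cinner :: "'a \<Rightarrow> 'a \<Rightarrow> complex"
  assumes cinner_commute: "cinner x y = cnj (cinner y x)"
    and cinner_add_left: "cinner (x + y) z = cinner x z + cinner y z"
    and cinner_scaleC_left: "cinner (c *\<^sub>C x) y = c * cinner x y"
    and inner_eq_Re_cinner: "inner x y = Re (cinner x y)"

class chilbert_space = complex_inner + banach

lemma cinner_add_right: "cinner x (y + z) = cinner x y + cinner x z"
  by (metis cinner_commute cinner_add_left complex_cnj_add)

lemma cinner_scaleC_right: "cinner x (c *\<^sub>C y) = cnj c * cinner x y"
  by (metis cinner_commute cinner_scaleC_left complex_cnj_mult)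

lemma Im_cinner: "Im (cinner x y) = inner x (\<i> *\<^sub>C y)"
  by (simp add: inner_eq_Re_cinner cinner_scaleC_right)

lemma cinner_eqI:
  assumes "\<And>x. cinner x y = cinner x z"
  shows "y = z"
proof -
  have "\<forall>x. inner x y = inner x z" by (simp add: inner_eq_Re_cinner assms)
  then show ?thesis by (simp only: vector_eq_ldot)
qed


section \<open>The C*-algebra of bounded operators\<close>

typedef (overloaded) 'h bop =
  "{T :: 'h::complex_normed_vector \<Rightarrow>\<^sub>L 'h. \<forall>c x. blinfun_apply T (c *\<^sub>C x) = c *\<^sub>C blinfun_apply T x}"
  morphisms blinfun_of_bop Abs_bop
  by (rule exI[of _ 0]) simp

setup_lifting type_definition_bop

abbreviation bop_apply :: "'h::complex_normed_vector bop \<Rightarrow> 'h \<Rightarrow> 'h" where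
  "bop_apply T \<equiv> blinfun_apply (blinfun_of_bop T)"

lemma bop_apply_scaleC: "bop_apply T (c *\<^sub>C x) = c *\<^sub>C bop_apply T x"
  by transfer simp

lemma bop_eqI: "(\<And>x. bop_apply S x = bop_apply T x) \<Longrightarrow> S = T"
  by transfer (rule blinfun_eqI)

lemma bounded_linear_scaleC: "bounded_linear (\<lambda>x::'a::complex_normed_vector. c *\<^sub>C x)"
  by (rule bounded_linear_intro[of _ "cmod c"])
    (simp_all add: scaleC_add_right norm_scaleC scaleR_scaleC scaleC_scaleC mult.commute)

lift_definition blinfun_scaleC :: "complex \<Rightarrow> 'a::complex_normed_vector \<Rightarrow>\<^sub>L 'a"
  is "\<lambda>c x. c *\<^sub>C x"
  by (rule bounded_linear_scaleC)

lemma norm_scaleC_blinfun: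
  fixes T :: "'b::real_normed_vector \<Rightarrow>\<^sub>L 'a::complex_normed_vector"
  shows "norm (blinfun_scaleC c o\<^sub>L T) = cmod c * norm T"
proof (rule antisym)
  have le: "norm (blinfun_scaleC c o\<^sub>L T) \<le> cmod c * norm T" for c and T :: "'b \<Rightarrow>\<^sub>L 'a"
  proof (rule norm_blinfun_bound)
    show "norm (blinfun_apply (blinfun_scaleC c o\<^sub>L T) x) \<le> cmod c * norm T * norm x" for x
      using mult_left_mono[OF norm_blinfun[of T x], of "cmod c"]
      by (simp add: blinfun_scaleC.rep_eq norm_scaleC mult.assoc)
  qed simp
  show "norm (blinfun_scaleC c o\<^sub>L T) \<le> cmod c * norm T" by (rule le)
  show "cmod c * norm T \<le> norm (blinfun_scaleC c o\<^sub>L T)"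
  proof (cases "c = 0")
    case False
    have T: "blinfun_scaleC (inverse c) o\<^sub>L (blinfun_scaleC c o\<^sub>L T) = T"
      using False by (intro blinfun_eqI) (simp add: blinfun_scaleC.rep_eq scaleC_scaleC scaleC_one)
    have "norm T \<le> cmod (inverse c) * norm (blinfun_scaleC c o\<^sub>L T)"
      using le[of "inverse c" "blinfun_scaleC c o\<^sub>L T"] unfolding T .
    then show ?thesis using False by (simp add: norm_inverse norm_divide field_simps)
  qed simp
qed

instantiation bop :: (complex_normed_vector) complex_normed_vector
begin

lift_definition zero_bop :: "'a bop" is 0 by simp
lift_definition plus_bop :: "'a bop \<Rightarrow> 'a bop \<Rightarrow> 'a bop" is "(+)"
  by (simp add: blinfun.bilinear_simps scaleC_add_right)
lift_definition minus_bop :: "'a bop \<Rightarrow> 'a bop \<Rightarrow> 'a bop" is "(-)"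
  by (simp add: blinfun.bilinear_simps complex_vector.scale_right_diff_distrib)
lift_definition uminus_bop :: "'a bop \<Rightarrow> 'a bop" is uminus
  by (simp add: blinfun.bilinear_simps)
lift_definition scaleR_bop :: "real \<Rightarrow> 'a bop \<Rightarrow> 'a bop" is scaleR
  by (simp add: blinfun.bilinear_simps scaleR_scaleC scaleC_scaleC mult.commute)
lift_definition scaleC_bop :: "complex \<Rightarrow> 'a bop \<Rightarrow> 'a bop" is "\<lambda>c T. blinfun_scaleC c o\<^sub>L T"
  by (simp add: blinfun_scaleC.rep_eq scaleC_scaleC mult.commute)
lift_definition norm_bop :: "'a bop \<Rightarrow> real" is norm .

definition dist_bop :: "'a bop \<Rightarrow> 'a bop \<Rightarrow> real" where
  "dist_bop S T = norm (S - T)"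
definition sgn_bop :: "'a bop \<Rightarrow> 'a bop" where
  "sgn_bop T = inverse (norm T) *\<^sub>R T"
definition uniformity_bop :: "('a bop \<times> 'a bop) filter" where
  "uniformity_bop = (INF e\<in>{0 <..}. principal {(S, T). dist S T < e})"
definition open_bop :: "'a bop set \<Rightarrow> bool" where
  "open_bop U = (\<forall>S\<in>U. \<forall>\<^sub>F (S', T) in uniformity. S' = S \<longrightarrow> T \<in> U)"

instance
proof
  fix S T U :: "'a bop" and r s :: real and c d :: complex
  show "S + T + U = S + (T + U)" by transfer simp
  show "S + T = T + S" by transfer simp
  show "0 + S = S" by transfer simp
  show "- S + S = 0" by transfer simp
  show "S - T = S + - T" by transfer simp
  show "r *\<^sub>R (S + T) = r *\<^sub>R S + r *\<^sub>R T" by transfer (simp add: scaleR_add_right)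
  show "(r + s) *\<^sub>R S = r *\<^sub>R S + s *\<^sub>R S" by transfer (simp add: scaleR_add_left)
  show "r *\<^sub>R s *\<^sub>R S = (r * s) *\<^sub>R S" by transfer simp
  show "1 *\<^sub>R S = S" by transfer simp
  show "c *\<^sub>C (S + T) = c *\<^sub>C S + c *\<^sub>C T"
    by transfer (auto intro!: blinfun_eqI simp: blinfun_scaleC.rep_eq blinfun.bilinear_simps scaleC_add_right)
  show "(c + d) *\<^sub>C S = c *\<^sub>C S + d *\<^sub>C S"
    by transfer (auto intro!: blinfun_eqI simp: blinfun_scaleC.rep_eq blinfun.bilinear_simps scaleC_add_left)
  show "c *\<^sub>C d *\<^sub>C S = (c * d) *\<^sub>C S"
    by transfer (auto intro!: blinfun_eqI simp: blinfun_scaleC.rep_eq scaleC_scaleC)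
  show "1 *\<^sub>C S = S"
    by transfer (auto intro!: blinfun_eqI simp: blinfun_scaleC.rep_eq scaleC_one)
  show "r *\<^sub>R S = complex_of_real r *\<^sub>C S"
    by transfer (auto intro!: blinfun_eqI simp: blinfun_scaleC.rep_eq blinfun.bilinear_simps scaleR_scaleC)
  show "dist S T = norm (S - T)" by (rule dist_bop_def)
  show "sgn S = inverse (norm S) *\<^sub>R S" by (rule sgn_bop_def)
  show "uniformity = (INF e\<in>{0 <..}. principal {(S, T :: 'a bop). dist S T < e})"
    by (rule uniformity_bop_def)
  show "open A = (\<forall>S\<in>A. \<forall>\<^sub>F (S', T) in uniformity. S' = S \<longrightarrow> T \<in> A)" for A :: "'a bop set"
    by (rule open_bop_def)
  show "(norm S = 0) = (S = 0)" by transfer simp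
  show "norm (S + T) \<le> norm S + norm T" by transfer (rule norm_triangle_ineq)
  show "norm (r *\<^sub>R S) = \<bar>r\<bar> * norm S" by transfer simp
  show "norm (c *\<^sub>C S) = cmod c * norm S" by transfer (rule norm_scaleC_blinfun)
qed

end

instantiation bop :: (complex_normed_vector) "{real_normed_algebra, monoid_mult}"
begin

lift_definition one_bop :: "'a bop" is id_blinfun by simp
lift_definition times_bop :: "'a bop \<Rightarrow> 'a bop \<Rightarrow> 'a bop" is "(o\<^sub>L)" by simp

instance
proof
  fix S T U :: "'a bop" and r :: real
  show "1 * S = S" "S * 1 = S" by (transfer; simp add: blinfun_eqI)+
  show "S * T * U = S * (T * U)" by transfer (simp add: blinfun_eqI)
  show "(S + T) * U = S * U + T * U"
    by transfer (auto intro!: blinfun_eqI simp: blinfun.bilinear_simps)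
  show "S * (T + U) = S * T + S * U"
    by transfer (auto intro!: blinfun_eqI simp: blinfun.bilinear_simps)
  show "(r *\<^sub>R S) * T = r *\<^sub>R (S * T)"
    by transfer (auto intro!: blinfun_eqI simp: blinfun.bilinear_simps)
  show "S * (r *\<^sub>R T) = r *\<^sub>R (S * T)"
    by transfer (auto intro!: blinfun_eqI simp: blinfun.bilinear_simps)
  show "norm (S * T) \<le> norm S * norm T" by transfer (rule norm_blinfun_compose)
qed

end

lemma bop_apply_simps:
  "bop_apply 0 x = 0"
  "bop_apply 1 x = x"
  "bop_apply (S + T) x = bop_apply S x + bop_apply T x"
  "bop_apply (S - T) x = bop_apply S x - bop_apply T x"
  "bop_apply (S * T) x = bop_apply S (bop_apply T x)"
  "bop_apply (c *\<^sub>C T) x = c *\<^sub>C bop_apply T x"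
  by (simp_all add: zero_bop.rep_eq one_bop.rep_eq plus_bop.rep_eq minus_bop.rep_eq
      times_bop.rep_eq scaleC_bop.rep_eq blinfun_scaleC.rep_eq blinfun.bilinear_simps)

instance bop :: (chilbert_space) banach
proof
  fix X :: "nat \<Rightarrow> 'a bop"
  assume "Cauchy X"
  then have "Cauchy (\<lambda>n. blinfun_of_bop (X n))"
    by (simp add: Cauchy_def dist_norm norm_bop.rep_eq minus_bop.rep_eq)
  then obtain L where L: "(\<lambda>n. blinfun_of_bop (X n)) \<longlonglongrightarrow> L"
    by (meson Cauchy_convergent_iff convergent_def)
  have app: "(\<lambda>n. bop_apply (X n) x) \<longlonglongrightarrow> blinfun_apply L x" for x
    by (rule blinfun.tendsto[OF L tendsto_const])
  have "blinfun_apply L (c *\<^sub>C x) = c *\<^sub>C blinfun_apply L x" for c x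
  proof (rule LIMSEQ_unique[OF app])
    show "(\<lambda>n. bop_apply (X n) (c *\<^sub>C x)) \<longlonglongrightarrow> c *\<^sub>C blinfun_apply L x"
      unfolding bop_apply_scaleC
      by (rule bounded_linear.tendsto[OF bounded_linear_scaleC app])
  qed
  then have "L = blinfun_of_bop (Abs_bop L)"
    by (subst Abs_bop_inverse) auto
  then obtain T where "L = blinfun_of_bop T" by blast
  with L have "X \<longlonglongrightarrow> T"
    by (simp add: LIMSEQ_iff norm_bop.rep_eq minus_bop.rep_eq)
  then show "convergent X" by (auto simp: convergent_def)
qed

lemma riesz_representation_real:
  fixes f :: "'a::{real_inner, complete_space} \<Rightarrow> real"
  assumes "bounded_linear f"
  shows "\<exists>y. \<forall>x. f x = inner x y"
proof -
  interpret f: bounded_linear f by fact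
  define J where "J x = inner x x - 2 * f x" for x
  obtain K where K: "\<And>x. \<bar>f x\<bar> \<le> norm x * K"
    using f.bounded by auto
  have J_bound: "- K\<^sup>2 \<le> J x" for x
  proof -
    have "0 \<le> (norm x - K)\<^sup>2" by simp
    then show ?thesis
      using K[of x] by (simp add: J_def power2_diff power2_norm_eq_inner[symmetric] abs_le_iff)
  qed
  then have bdd: "bdd_below (range J)" by (intro bdd_belowI) auto
  define m where "m = Inf (range J)"
  have m_le: "m \<le> J x" for x unfolding m_def by (intro cInf_lower bdd) auto
  have "\<exists>x. J x < m + 1 / real (Suc n)" for n
  proof -
    have "m < m + 1 / real (Suc n)" by simp
    then show ?thesis unfolding m_def by (subst (asm) cInf_less_iff) (auto intro: bdd)
  qed
  then obtain X where X: "\<And>n. J (X n) < m + 1 / real (Suc n)" by metis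
  have par: "(norm (x - y))\<^sup>2 = 2 * J x + 2 * J y - 4 * J ((1/2) *\<^sub>R (x + y))" for x y
    unfolding J_def power2_norm_eq_inner
    by (simp add: f.add f.scaleR inner_simps inner_commute algebra_simps)
  have near: "(norm (X i - X j))\<^sup>2 \<le> 2 / real (Suc i) + 2 / real (Suc j)" for i j
    using par[of "X i" "X j"] X[of i] X[of j] m_le[of "(1/2) *\<^sub>R (X i + X j)"]
    by linarith
  have "Cauchy X"
  proof (rule metric_CauchyI)
    fix e :: real assume "0 < e"
    then obtain M where M: "4 / e\<^sup>2 < real M" using reals_Archimedean2 by blast
    have "dist (X i) (X j) < e" if "i \<ge> M" "j \<ge> M" for i j
    proof -
      have M0: "0 < real M" using \<open>0 < e\<close> by (intro less_trans[OF _ M]) simp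
      have "2 / real (Suc i) \<le> 2 / real M" "2 / real (Suc j) \<le> 2 / real M"
        using that M0 by (auto intro!: divide_left_mono)
      moreover have "4 / real M < e\<^sup>2" using M M0 \<open>0 < e\<close> by (simp add: field_simps)
      ultimately have "(norm (X i - X j))\<^sup>2 < e\<^sup>2" using near[of i j] by simp
      then show ?thesis using \<open>0 < e\<close> by (simp add: dist_norm power_less_imp_less_base)
    qed
    then show "\<exists>M. \<forall>i\<ge>M. \<forall>j\<ge>M. dist (X i) (X j) < e" by blast
  qed
  then obtain L where L: "X \<longlonglongrightarrow> L" by (meson Cauchy_convergent_iff convergent_def)
  have "(\<lambda>n. J (X n)) \<longlonglongrightarrow> J L"
    unfolding J_def by (intro tendsto_intros f.tendsto L)
  moreover have "(\<lambda>n. m + 1 / real (Suc n)) \<longlonglongrightarrow> m + 0"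
    by (intro tendsto_intros LIMSEQ_Suc lim_1_over_n)
  ultimately have JL: "J L \<le> m"
    using X by (intro LIMSEQ_le[of "\<lambda>n. J (X n)" _ "\<lambda>n. m + 1 / real (Suc n)"]) (auto intro: less_imp_le)
  have "f x = inner x L" for x
  proof (cases "x = 0")
    case False
    define a where "a = inner x L - f x"
    define t where "t = - a / inner x x"
    have pos: "inner x x > 0" using False by simp
    have "J L \<le> J (L + t *\<^sub>R x)" using JL m_le[of "L + t *\<^sub>R x"] by simp
    then have "0 \<le> 2 * t * a + t * t * inner x x"
      by (simp add: J_def a_def f.add f.scaleR inner_simps inner_commute algebra_simps)
    also have "\<dots> = - (a * a) / inner x x" using pos by (simp add: t_def field_simps)
    finally have "a * a \<le> 0" using pos by (simp add: field_simps)
    then have "a = 0" by (auto simp: mult_le_0_iff)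
    then show ?thesis by (simp add: a_def)
  qed (simp add: f.zero)
  then show ?thesis by blast
qed

lemma bop_adjoint_exists:
  fixes T :: "'h::chilbert_space bop"
  shows "\<exists>S. \<forall>x y. cinner (bop_apply T x) y = cinner x (bop_apply S y)"
proof -
  have "\<exists>z. \<forall>x. inner (bop_apply T x) y = inner x z" for y
    by (intro riesz_representation_real bounded_linear_intros)
  then obtain S where S: "\<And>x y. inner (bop_apply T x) y = inner x (S y)" by metis
  have cS: "cinner (bop_apply T x) y = cinner x (S y)" for x y
  proof (rule complex_eqI)
    have "Im (cinner (bop_apply T x) y) = - Re (cinner (bop_apply T (\<i> *\<^sub>C x)) y)" for y
      by (simp add: bop_apply_scaleC cinner_scaleC_left)
    moreover have "Im (cinner x z) = - Re (cinner (\<i> *\<^sub>C x) z)" for z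
      by (simp add: cinner_scaleC_left)
    ultimately show "Im (cinner (bop_apply T x) y) = Im (cinner x (S y))"
      using S[of "\<i> *\<^sub>C x" y] by (simp add: inner_eq_Re_cinner)
  qed (use S[of x y] in \<open>simp add: inner_eq_Re_cinner\<close>)
  have add: "S (y + z) = S y + S z" for y z
    by (rule cinner_eqI) (simp add: cS[symmetric] cinner_add_right)
  have scaleC: "S (c *\<^sub>C y) = c *\<^sub>C S y" for c y
    by (rule cinner_eqI) (simp add: cS[symmetric] cinner_scaleC_right)
  have bound: "norm (S y) \<le> norm y * norm T" for y
  proof (cases "S y = 0")
    case False
    have "norm (S y) * norm (S y) = inner (bop_apply T (S y)) y"
      by (simp add: S power2_norm_eq_inner[symmetric] power2_eq_square)
    also have "\<dots> \<le> norm (bop_apply T (S y)) * norm y" by (rule norm_cauchy_schwarz)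
    also have "\<dots> \<le> (norm T * norm (S y)) * norm y"
      by (intro mult_right_mono) (auto simp: norm_bop.rep_eq norm_blinfun)
    finally have "norm (S y) * norm (S y) \<le> norm (S y) * (norm y * norm T)"
      by (simp add: mult_ac)
    then show ?thesis using False by simp
  qed simp
  have "bounded_linear S"
    by (rule bounded_linear_intro[of _ "norm T"]) (auto simp: add scaleR_scaleC scaleC bound)
  then have *: "blinfun_apply (Blinfun S) = S" by (rule bounded_linear_Blinfun_apply)
  then have "bop_apply (Abs_bop (Blinfun S)) = S"
    by (subst Abs_bop_inverse) (simp_all add: scaleC)
  then show ?thesis by (intro exI[of _ "Abs_bop (Blinfun S)"]) (simp add: cS)
qed

instantiation bop :: (chilbert_space) cstar_algebra
begin

definition star_bop :: "'a bop \<Rightarrow> 'a bop" where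
  "star_bop T = (THE S. \<forall>x y. cinner (bop_apply T x) y = cinner x (bop_apply S y))"

lemma star_bop_unique:
  fixes S T :: "'a bop"
  assumes "\<And>x y. cinner (bop_apply T x) y = cinner x (bop_apply S y)"
  shows "star T = S"
  unfolding star_bop_def
proof (rule the_equality)
  show "\<forall>x y. cinner (bop_apply T x) y = cinner x (bop_apply S y)" by (intro allI assms)
  fix R
  assume R: "\<forall>x y. cinner (bop_apply T x) y = cinner x (bop_apply R y)"
  have "cinner x (bop_apply R y) = cinner x (bop_apply S y)" for x y
    by (rule trans[OF R[rule_format, symmetric] assms])
  then show "R = S" by (intro bop_eqI cinner_eqI)
qed

lemma cinner_star_right:
  fixes T :: "'a bop"
  shows "cinner x (bop_apply (star T) y) = cinner (bop_apply T x) y"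
proof -
  obtain S where S: "\<And>x y. cinner (bop_apply T x) y = cinner x (bop_apply S y)"
    using bop_adjoint_exists[of T] by blast
  from S have "star T = S" by (rule star_bop_unique)
  then show ?thesis by (simp only: S)
qed

lemma cinner_star_left:
  fixes T :: "'a bop"
  shows "cinner (bop_apply (star T) x) y = cinner x (bop_apply T y)"
proof -
  have "cinner (bop_apply (star T) x) y = cnj (cinner y (bop_apply (star T) x))"
    by (rule cinner_commute)
  also have "\<dots> = cnj (cinner (bop_apply T y) x)" by (simp only: cinner_star_right)
  also have "\<dots> = cinner x (bop_apply T y)" by (rule cinner_commute[symmetric])
  finally show ?thesis .
qed

instance
proof
  fix S T :: "'a bop" and c :: complex
  show "(c *\<^sub>C S) * T = c *\<^sub>C (S * T)" by (rule bop_eqI) (simp add: bop_apply_simps)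
  show "S * (c *\<^sub>C T) = c *\<^sub>C (S * T)"
    by (rule bop_eqI) (simp add: bop_apply_simps bop_apply_scaleC)
  show "star (S + T) = star S + star T"
    by (rule star_bop_unique)
      (simp add: bop_apply_simps cinner_add_left cinner_add_right cinner_star_right)
  show "star (c *\<^sub>C S) = cnj c *\<^sub>C star S"
    by (rule star_bop_unique)
      (simp add: bop_apply_simps cinner_scaleC_left cinner_scaleC_right cinner_star_right)
  show "star (S * T) = star T * star S"
    by (rule star_bop_unique) (simp add: bop_apply_simps cinner_star_right)
  show ss: "star (star S) = S" for S :: "'a bop"
    by (rule star_bop_unique) (simp add: cinner_star_left)
  have bound: "norm (bop_apply T x) \<le> norm T * norm x" for T :: "'a bop" and x
    by (simp add: norm_bop.rep_eq norm_blinfun)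
  have sq: "(norm T)\<^sup>2 \<le> norm (star T * T)" for T :: "'a bop"
  proof -
    have "norm (bop_apply T x) \<le> sqrt (norm (star T * T)) * norm x" for x
    proof -
      have "(norm (bop_apply T x))\<^sup>2 = inner (bop_apply (star T * T) x) x"
        by (simp add: power2_norm_eq_inner inner_eq_Re_cinner bop_apply_simps cinner_star_left)
      also have "\<dots> \<le> norm (bop_apply (star T * T) x) * norm x" by (rule norm_cauchy_schwarz)
      also have "\<dots> \<le> norm (star T * T) * norm x * norm x" by (intro mult_right_mono bound) simp
      finally have "(norm (bop_apply T x))\<^sup>2 \<le> (sqrt (norm (star T * T)) * norm x)\<^sup>2"
        by (simp add: power_mult_distrib) (simp add: power2_eq_square mult.assoc)
      then show ?thesis by (rule power2_le_imp_le) simp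
    qed
    then have "norm T \<le> sqrt (norm (star T * T))"
      unfolding norm_bop.rep_eq[of T] by (intro norm_blinfun_bound) auto
    then show ?thesis by (metis norm_ge_zero power_mono real_sqrt_pow2)
  qed
  have le: "norm T \<le> norm (star T)" for T :: "'a bop"
  proof (cases "T = 0")
    case False
    have "norm T * norm T \<le> norm (star T) * norm T"
      using sq[of T] norm_mult_ineq[of "star T" T] by (simp add: power2_eq_square)
    then show ?thesis using False by simp
  qed simp
  have "norm (star S) = norm S" using le[of S] le[of "star S"] by (simp add: ss)
  then show "norm (star S * S) = (norm S)\<^sup>2"
    using sq[of S] norm_mult_ineq[of "star S" S] by (simp add: power2_eq_square)
qed

end


section \<open>Regular subalgebras of C*-algebras\<close>

definition star_subalgebra :: "'a::cstar_algebra set \<Rightarrow> bool" where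
  "star_subalgebra B \<longleftrightarrow> module.subspace scaleC B \<and>
    (\<forall>x\<in>B. \<forall>y\<in>B. x * y \<in> B) \<and> (\<forall>x\<in>B. star x \<in> B)"

definition abelian :: "'a::cstar_algebra set \<Rightarrow> bool" where
  "abelian B \<longleftrightarrow> (\<forall>x\<in>B. \<forall>y\<in>B. x * y = y * x)"

definition cstar_generated :: "'a::cstar_algebra set \<Rightarrow> 'a set" where
  "cstar_generated S = \<Inter> {B. star_subalgebra B \<and> closed B \<and> S \<subseteq> B}"

definition cstar_normalizer :: "'a::cstar_algebra set \<Rightarrow> 'a set" where
  "cstar_normalizer C = {n. (\<forall>c\<in>C. n * c * star n \<in> C) \<and> (\<forall>c\<in>C. star n * c * n \<in> C)}"

text \<open>The ambient C*-algebra is the whole type.\<close>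

definition cstar_regular :: "'a::cstar_algebra set \<Rightarrow> bool" where
  "cstar_regular C \<longleftrightarrow> cstar_generated (cstar_normalizer C) = UNIV"

definition star_hom :: "('a::cstar_algebra \<Rightarrow> 'b::cstar_algebra) \<Rightarrow> bool" where
  "star_hom \<pi> \<longleftrightarrow> (\<forall>x y. \<pi> (x + y) = \<pi> x + \<pi> y) \<and> (\<forall>c x. \<pi> (c *\<^sub>C x) = c *\<^sub>C \<pi> x) \<and>
    (\<forall>x y. \<pi> (x * y) = \<pi> x * \<pi> y) \<and> (\<forall>x. \<pi> (star x) = star (\<pi> x))"


section \<open>Von Neumann algebras\<close>

definition commutant :: "'h::chilbert_space bop set \<Rightarrow> 'h bop set" where
  "commutant S = {T. \<forall>s\<in>S. T * s = s * T}"

definition bicommutant :: "'h::chilbert_space bop set \<Rightarrow> 'h bop set" where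
  "bicommutant S = commutant (commutant S)"

definition von_neumann_algebra :: "'h::chilbert_space bop set \<Rightarrow> bool" where
  "von_neumann_algebra M \<longleftrightarrow> star_subalgebra M \<and> bicommutant M = M"

definition unitaries :: "'h::chilbert_space bop set \<Rightarrow> 'h bop set" where
  "unitaries M = {u\<in>M. star u * u = 1 \<and> u * star u = 1}"

definition vn_normalizer :: "'h::chilbert_space bop set \<Rightarrow> 'h bop set \<Rightarrow> 'h bop set" where
  "vn_normalizer M N = {u \<in> unitaries M. (\<lambda>x. u * x * star u) ` N = N}"

definition vn_regular :: "'h::chilbert_space bop set \<Rightarrow> 'h bop set \<Rightarrow> bool" where
  "vn_regular M N \<longleftrightarrow> bicommutant (vn_normalizer M N) = M"

definition projections :: "'h::chilbert_space bop set \<Rightarrow> 'h bop set" where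
  "projections M = {p\<in>M. p * p = p \<and> star p = p}"

definition subprojection :: "'h::chilbert_space bop \<Rightarrow> 'h bop \<Rightarrow> bool" where
  "subprojection q p \<longleftrightarrow> p * q = q"

definition murray_von_neumann_equiv ::
  "'h::chilbert_space bop set \<Rightarrow> 'h bop \<Rightarrow> 'h bop \<Rightarrow> bool" where
  "murray_von_neumann_equiv M p q \<longleftrightarrow> (\<exists>v\<in>M. star v * v = p \<and> v * star v = q)"

definition finite_projection :: "'h::chilbert_space bop set \<Rightarrow> 'h bop \<Rightarrow> bool" where
  "finite_projection M p \<longleftrightarrow> p \<in> projections M \<and>
    (\<forall>q\<in>projections M. subprojection q p \<and> murray_von_neumann_equiv M q p \<longrightarrow> q = p)"

definition abelian_projection :: "'h::chilbert_space bop set \<Rightarrow> 'h bop \<Rightarrow> bool" where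
  "abelian_projection M p \<longleftrightarrow> p \<in> projections M \<and> abelian ((\<lambda>x. p * x * p) ` M)"

definition minimal_projection :: "'h::chilbert_space bop set \<Rightarrow> 'h bop \<Rightarrow> bool" where
  "minimal_projection M p \<longleftrightarrow> p \<in> projections M \<and> p \<noteq> 0 \<and>
    (\<forall>q\<in>projections M. subprojection q p \<longrightarrow> q = 0 \<or> q = p)"

definition vn_center :: "'h::chilbert_space bop set \<Rightarrow> 'h bop set" where
  "vn_center M = M \<inter> commutant M"

definition finite_vna :: "'h::chilbert_space bop set \<Rightarrow> bool" where
  "finite_vna M \<longleftrightarrow> von_neumann_algebra M \<and> finite_projection M 1"

text \<open>Type II: there is no nonzero abelian projection, and every nonzero central projection dominates
  a nonzero finite one. Type II\<open>\<^sub>1\<close>: moreover the algebra is finite.\<close>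

definition type_II_vna :: "'h::chilbert_space bop set \<Rightarrow> bool" where
  "type_II_vna M \<longleftrightarrow> von_neumann_algebra M \<and> (\<forall>p. abelian_projection M p \<longrightarrow> p = 0) \<and>
    (\<forall>z \<in> projections (vn_center M). z \<noteq> 0 \<longrightarrow>
      (\<exists>p. finite_projection M p \<and> p \<noteq> 0 \<and> subprojection p z))"

text \<open>The zero algebra, which occurs when the Hilbert space is zero, is not a factor.\<close>

definition vn_factor :: "'h::chilbert_space bop set \<Rightarrow> bool" where
  "vn_factor M \<longleftrightarrow> von_neumann_algebra M \<and> vn_center M = range (\<lambda>c. c *\<^sub>C 1) \<and> (1 :: 'h bop) \<noteq> 0"

definition type_II1_factor :: "'h::chilbert_space bop set \<Rightarrow> bool" where
  "type_II1_factor M \<longleftrightarrow> vn_factor M \<and> type_II_vna M \<and> finite_vna M"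

definition diffuse :: "'h::chilbert_space bop set \<Rightarrow> bool" where
  "diffuse M \<longleftrightarrow> von_neumann_algebra M \<and> \<not> (\<exists>p. minimal_projection M p)"

definition finite_dimensional :: "'a::complex_vector set \<Rightarrow> bool" where
  "finite_dimensional V \<longleftrightarrow> (\<exists>B. finite B \<and> module.span scaleC B = V)"

end

theory Submission
  imports Defs
begin

text \<open>
  Write \<open>M = \<pi>(A)''\<close>, \<open>D = \<pi>(C)\<close> and \<open>N = D''\<close>. A normalizer \<open>n\<close> of \<open>C\<close> has as polar part a partial
  isometry that implements, after cutting away the common kernel of \<open>D\<close>, a partial automorphism
  of the abelian algebra \<open>N\<close>. It splits into a fixed part, where the partial isometry lies in \<open>N'\<close>, and
  pieces that are moved off themselves. A moved piece plus its adjoint exchanges two disjoint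
  projections and extends by the identity to a symmetry normalizing \<open>N\<close>; the fixed part lies in
  \<open>M \<inter> N'\<close>, whose unitaries normalize \<open>N\<close> trivially. Hence the unitary normalizer generates \<open>M\<close>.

  The proof runs this idea through commutants. It is enough that every \<open>T\<close> commuting with the unitary
  normalizer commutes with \<open>\<pi>(n)\<close>; then regularity of \<open>C\<close> and continuity of \<open>\<pi>\<close>
  (\<open>star_hom_contractive\<close>) put \<open>T\<close> in \<open>M'\<close>. Moved pieces are treated in
  \<open>commutant_vn_normalizer_corner\<close>, the fixed part in \<open>commutant_vn_normalizer_commutes\<close>, and
  \<open>normalizing_element_commutes\<close> combines them by looking at the largest projection of \<open>N\<close> under which
  the commutator of \<open>T\<close> with the given element vanishes. Finally \<open>cstar_normalizer_commutes\<close> deals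
  with the fact that \<open>D\<close> may act degenerately and that \<open>\<pi>(n)\<^sup>* \<pi>(n)\<close> need not belong to \<open>N\<close>.

  Three tools replace spectral theory: square roots as fixed points of \<open>b = (h + b\<^sup>2)/2\<close>
  (\<open>quadratic_iteration_fixed_point\<close>), projections onto common kernels
  (\<open>right_annihilator_projection\<close>), and the polar decomposition of a self-adjoint operator into a
  symmetry and an absolute value that they yield (\<open>sign_decomposition\<close>). The last one implies that
  projections are total in a von Neumann algebra (\<open>projections_total\<close>).

  For a finite factor \<open>M\<close>, a minimal projection of \<open>N\<close> has an orbit under the normalizer consisting of
  orthogonal equivalent projections. Finiteness bounds the orbit, as infinitely many would carry a shift
  (\<open>finite_vna_no_infinite_orbit\<close>). The sum of the orbit commutes with the normalizer, so it is a
  central projection, that is \<open>1\<close>, and \<open>N\<close> is spanned by the orbit.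
\<close>

section \<open>Square roots by iteration\<close>

text \<open>A square root without functional calculus: a solution \<open>b\<close> of \<open>2 b = h + b\<^sup>2\<close> satisfies
  \<open>(1 - b)\<^sup>2 = 1 - h\<close>. For \<open>\<parallel>h\<parallel> < 1\<close> the iteration below would be a contraction. At the boundary
  \<open>\<parallel>h\<parallel> = 1\<close> it still converges in norm, because its increments are dominated by those of the same
  iteration for the scalar \<open>h = 1\<close>, which is monotone and bounded by \<open>1\<close>. The set \<open>B\<close> records
  further properties of \<open>b\<close>, such as being self-adjoint or lying in a given closed subalgebra.\<close>

lemma quadratic_iteration_fixed_point:
  fixes h :: "'a::{real_normed_algebra,banach}"
  assumes h: "norm h \<le> 1" and "closed B" and "0 \<in> B"
    and step: "\<And>x. x \<in> B \<Longrightarrow> (1/2) *\<^sub>R (h + x * x) \<in> B"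
  shows "\<exists>b\<in>B. norm b \<le> 1 \<and> b = (1/2) *\<^sub>R (h + b * b)"
proof -
  define F where "F x = (1/2) *\<^sub>R (h + x * x)" for x
  define \<phi> :: "real \<Rightarrow> real" where "\<phi> t = (1 + t * t) / 2" for t
  define b where "b n = (F ^^ n) 0" for n
  define \<beta> where "\<beta> n = (\<phi> ^^ n) 0" for n
  have b0: "b 0 = 0" and bS: "b (Suc n) = F (b n)" for n by (simp_all add: b_def)
  have \<beta>0: "\<beta> 0 = 0" and \<beta>S: "\<beta> (Suc n) = \<phi> (\<beta> n)" for n by (simp_all add: \<beta>_def)
  have bB: "b n \<in> B" for n
    by (induction n) (use assms in \<open>auto simp: b0 bS F_def\<close>)
  have \<beta>01: "0 \<le> \<beta> n \<and> \<beta> n \<le> 1" for n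
  proof (induction n)
    case (Suc n)
    then have "\<beta> n * \<beta> n \<le> 1" by (simp add: mult_le_one)
    with Suc show ?case by (simp add: \<beta>S \<phi>_def)
  qed (simp add: \<beta>0)
  have nb: "norm (b n) \<le> \<beta> n" for n
  proof (induction n)
    case (Suc n)
    have "norm (b n * b n) \<le> \<beta> n * \<beta> n"
      using norm_mult_ineq[of "b n" "b n"] mult_mono[OF Suc Suc] \<beta>01[of n] by (simp add: order_trans)
    then have "norm (h + b n * b n) \<le> 1 + \<beta> n * \<beta> n"
      using h norm_triangle_ineq[of h "b n * b n"] by linarith
    then show ?case by (simp add: bS \<beta>S F_def \<phi>_def)
  qed (simp add: b0 \<beta>0)
  have db: "norm (b (Suc n) - b n) \<le> \<beta> (Suc n) - \<beta> n" for n
  proof (induction n)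
    case 0
    show ?case using h by (simp add: bS b0 \<beta>S \<beta>0 F_def \<phi>_def)
  next
    case (Suc n)
    let ?x = "b (Suc n)" and ?y = "b n"
    have "F ?x - F ?y = (1/2) *\<^sub>R (?x * (?x - ?y) + (?x - ?y) * ?y)"
      by (simp add: F_def algebra_simps)
    also have "norm \<dots> \<le> (1/2) * (norm (?x * (?x - ?y)) + norm ((?x - ?y) * ?y))"
      using norm_triangle_ineq by simp
    also have "\<dots> \<le> (1/2) * (norm ?x * norm (?x - ?y) + norm (?x - ?y) * norm ?y)"
      by (intro mult_left_mono add_mono norm_mult_ineq) simp
    also have "\<dots> \<le> (1/2) * (\<beta> (Suc n) * (\<beta> (Suc n) - \<beta> n) + (\<beta> (Suc n) - \<beta> n) * \<beta> n)"
      using Suc nb[of n] nb[of "Suc n"] \<beta>01 order_trans[OF norm_ge_zero Suc]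
      by (intro mult_left_mono add_mono mult_mono) auto
    also have "\<dots> = \<phi> (\<beta> (Suc n)) - \<phi> (\<beta> n)" by (simp add: \<phi>_def field_simps)
    finally show ?case by (simp add: bS \<beta>S)
  qed
  have "incseq \<beta>" using db by (intro incseq_SucI) (metis norm_ge_zero diff_ge_0_iff_ge order_trans)
  moreover have "bdd_above (range \<beta>)" using \<beta>01 by (intro bdd_aboveI[of _ 1]) auto
  ultimately have "convergent \<beta>" by (metis LIMSEQ_incseq_SUP convergentI)
  then obtain l where l: "\<beta> \<longlonglongrightarrow> l" by (auto simp: convergent_def)
  have "(\<lambda>n. \<beta> (Suc n) - \<beta> n) sums (l - \<beta> 0)"
    using l by (rule telescope_sums)
  then have "summable (\<lambda>n. \<beta> (Suc n) - \<beta> n)" by (rule sums_summable)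
  then have "summable (\<lambda>n. b (Suc n) - b n)"
    using db by (auto intro: summable_comparison_test')
  then obtain s where "(\<lambda>n. b (Suc n) - b n) sums s" by (auto simp: summable_def)
  then have lim: "b \<longlonglongrightarrow> s" by (simp add: sums_def sum_lessThan_telescope b0)
  have "s \<in> B" using \<open>closed B\<close> bB lim closed_sequentially by blast
  moreover have "norm s \<le> 1"
    using lim nb \<beta>01 by (intro Lim_norm_ubound[OF _ lim]) (auto intro: order_trans eventuallyI)
  moreover have "(\<lambda>n. b (Suc n)) \<longlonglongrightarrow> F s"
    unfolding bS F_def by (intro tendsto_intros lim)
  then have "s = F s" using LIMSEQ_Suc[OF lim] LIMSEQ_unique by blast
  ultimately show ?thesis unfolding F_def by blast
qed

section \<open>Representations are contractive\<close>

lemma star_zero [simp]: "star (0::'a::cstar_algebra) = 0"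
  using star_scaleC[of 0 "0::'a"] by simp

lemma star_uminus: "star (- x) = - star (x::'a::cstar_algebra)"
  using star_scaleC[of "-1" x] by simp

lemma star_diff: "star (x - y) = star x - star (y::'a::cstar_algebra)"
  using star_add[of x "- y"] by (simp add: star_uminus)

lemma star_scaleR: "star (r *\<^sub>R x) = r *\<^sub>R star (x::'a::cstar_algebra)"
  by (simp add: scaleR_scaleC star_scaleC)

lemma star_mult_self_eq_0: "star x * x = 0 \<longleftrightarrow> (x::'a::cstar_algebra) = 0"
  using norm_star_mult[of x] by auto

lemma norm_star [simp]: "norm (star x) = norm (x::'a::cstar_algebra)"
proof -
  have le: "norm x \<le> norm (star x)" for x :: 'a
  proof (cases "x = 0")
    case False
    have "norm x * norm x \<le> norm (star x) * norm x"
      using norm_mult_ineq[of "star x" x] by (simp add: norm_star_mult power2_eq_square)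
    with False show ?thesis by simp
  qed simp
  show ?thesis using le[of x] le[of "star x"] by (simp add: star_star)
qed

lemma bounded_linear_star: "bounded_linear (star :: 'a::cstar_algebra \<Rightarrow> 'a)"
  by (rule bounded_linear_intro[of _ 1]) (simp_all add: star_add star_scaleR)

lemma closed_self_adjoint: "closed {x::'a::cstar_algebra. star x = x}"
  by (intro closed_Collect_eq continuous_intros
      linear_continuous_on[OF bounded_linear_star])

lemma star_one [simp]: "star (1::'h::chilbert_space bop) = 1"
  by (metis mult_1 mult_1_right star_mult star_star)

lemma inner_star_left:
  fixes T :: "'h::chilbert_space bop"
  shows "inner (bop_apply (star T) x) y = inner x (bop_apply T y)"
  by (simp add: inner_eq_Re_cinner cinner_star_left)

lemma bop_apply_scaleR: "bop_apply (r *\<^sub>R T) x = r *\<^sub>R bop_apply T x"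
  by (simp add: scaleR_scaleC bop_apply_simps)

lemma norm_bop_apply_le: "norm (bop_apply T x) \<le> norm T * norm x"
  by (simp add: norm_bop.rep_eq norm_blinfun)

lemma norm_bop_leI:
  assumes "0 \<le> r" "\<And>x. norm (bop_apply T x) \<le> r * norm x"
  shows "norm T \<le> r"
  unfolding norm_bop.rep_eq by (rule norm_blinfun_bound) (use assms in auto)

text \<open>Continuity is automatic even for an algebra without unit. For self-adjoint \<open>a\<close> in the unit ball, a
  self-adjoint \<open>b\<close> with \<open>2 b = a\<^sup>2 + b\<^sup>2\<close> exists in the algebra itself, and it plays the part of
  \<open>1 - sqrt (1 - a\<^sup>2)\<close>: its image \<open>Q\<close> gives \<open>1 - \<pi>(a)\<^sup>2 = (1 - Q)\<^sup>2 \<ge> 0\<close>. The general case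
  reduces to \<open>x\<^sup>* x\<close> by the C*-identity.\<close>

lemma star_hom_contractive:
  fixes \<pi> :: "'a::cstar_algebra \<Rightarrow> 'h::chilbert_space bop"
  assumes \<pi>: "star_hom \<pi>"
  shows "norm (\<pi> x) \<le> norm x"
proof -
  have add: "\<pi> (x + y) = \<pi> x + \<pi> y" and sc: "\<pi> (c *\<^sub>C x) = c *\<^sub>C \<pi> x"
    and mult: "\<pi> (x * y) = \<pi> x * \<pi> y" and st: "\<pi> (star x) = star (\<pi> x)" for x y c
    using \<pi> by (auto simp: star_hom_def)
  have scR: "\<pi> (r *\<^sub>R x) = r *\<^sub>R \<pi> x" for r x by (simp add: scaleR_scaleC sc)
  have unit: "norm (\<pi> a) \<le> 1" if sa: "star a = a" and a: "norm a \<le> 1" for a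
  proof -
    have "norm (a * a) \<le> 1"
      using norm_mult_ineq[of a a] mult_le_one[OF a norm_ge_zero a] by linarith
    then obtain b where b: "star b = b" "b = (1/2) *\<^sub>R (a * a + b * b)"
      using quadratic_iteration_fixed_point[of "a * a" "{x. star x = x}"]
      by (auto simp: closed_self_adjoint star_add star_mult star_scaleR sa)
    define P Q where "P = \<pi> a" and "Q = \<pi> b"
    have P: "star P = P" and Q: "star Q = Q" using sa b(1) by (metis P_def Q_def st)+
    have Q_eq: "Q = (1/2) *\<^sub>R (P * P + Q * Q)"
      unfolding P_def Q_def by (metis b(2) add mult scR)
    have "P * P + Q * Q = 2 *\<^sub>R ((1/2) *\<^sub>R (P * P + Q * Q))" by simp
    also have "\<dots> = 2 *\<^sub>R Q" by (simp only: Q_eq[symmetric])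
    finally have PP: "P * P = 2 *\<^sub>R Q - Q * Q" by (simp only: add_diff_cancel_right' eq_diff_eq)
    have "norm (bop_apply P k) \<le> 1 * norm k" for k
    proof -
      \<comment> \<open>the defect \<open>\<parallel>k\<parallel>\<^sup>2 - \<parallel>P k\<parallel>\<^sup>2\<close> is \<open>\<parallel>(1 - Q) k\<parallel>\<^sup>2\<close>\<close>
      have "(norm (bop_apply P k))\<^sup>2 = inner (bop_apply (P * P) k) k"
        using inner_star_left[of P "bop_apply P k" k] by (simp add: P power2_norm_eq_inner bop_apply_simps)
      also have "\<dots> = 2 * inner (bop_apply Q k) k - inner (bop_apply Q k) (bop_apply Q k)"
        using inner_star_left[of Q "bop_apply Q k" k]
        by (simp add: PP Q bop_apply_simps bop_apply_scaleR inner_diff_left)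
      also have "\<dots> = (norm k)\<^sup>2 - (norm (k - bop_apply Q k))\<^sup>2"
        by (simp add: power2_norm_eq_inner inner_diff_left inner_diff_right inner_commute)
      finally have "(norm (bop_apply P k))\<^sup>2 \<le> (norm k)\<^sup>2" by simp
      then show ?thesis using power2_le_imp_le[OF _ norm_ge_zero] by simp
    qed
    then show ?thesis unfolding P_def[symmetric] by (intro norm_bop_leI) auto
  qed
  have sa: "norm (\<pi> a) \<le> norm a" if "star a = a" for a
  proof (cases "a = 0")
    case True
    then show ?thesis using scR[of 0 0] by simp
  next
    case False
    have "norm (\<pi> ((1 / norm a) *\<^sub>R a)) \<le> 1"
      using False that by (intro unit) (simp_all add: star_scaleR)
    then show ?thesis using False by (simp add: scR divide_simps)
  qed
  have "(norm (\<pi> x))\<^sup>2 = norm (\<pi> (star x * x))" by (simp add: mult st norm_star_mult)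
  also have "\<dots> \<le> norm (star x * x)" by (rule sa) (simp add: star_mult star_star)
  finally show ?thesis unfolding norm_star_mult by (rule power2_le_imp_le) simp
qed

section \<open>Projections onto common kernels\<close>

text \<open>The nearest point: by the parallelogram law a minimizing sequence in \<open>L\<close> is Cauchy.\<close>

lemma exists_orthogonal_projection:
  fixes L :: "'a::{real_inner,complete_space} set"
  assumes L: "subspace L" "closed L"
  shows "\<exists>y\<in>L. \<forall>l\<in>L. inner (x - y) l = 0"
proof -
  define J where "J y = (norm (x - y))\<^sup>2" for y
  have bdd: "bdd_below (J ` L)" by (rule bdd_belowI[of _ 0]) (auto simp: J_def)
  have ne: "J ` L \<noteq> {}" using subspace_0[OF L(1)] by blast
  define m where "m = Inf (J ` L)"
  have m_le: "m \<le> J y" if "y \<in> L" for y unfolding m_def using that by (intro cInf_lower bdd) auto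
  have "\<exists>y\<in>L. J y < m + 1 / real (Suc n)" for n
  proof -
    have "m < m + 1 / real (Suc n)" by simp
    then show ?thesis unfolding m_def using ne by (subst (asm) cInf_less_iff) (auto intro: bdd)
  qed
  then obtain X where XL: "\<And>n. X n \<in> L" and X: "\<And>n. J (X n) < m + 1 / real (Suc n)" by metis
  have par: "(norm (u - v))\<^sup>2 = 2 * J u + 2 * J v - 4 * J ((1/2) *\<^sub>R (u + v))" for u v
    unfolding J_def power2_norm_eq_inner
    by (simp add: inner_simps inner_commute algebra_simps)
  have near: "(norm (X i - X j))\<^sup>2 \<le> 2 / real (Suc i) + 2 / real (Suc j)" for i j
  proof -
    have "(1/2) *\<^sub>R (X i + X j) \<in> L"
      by (intro subspace_scale subspace_add L XL)
    from m_le[OF this] par[of "X i" "X j"] X[of i] X[of j] show ?thesis by linarith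
  qed
  have "Cauchy X"
  proof (rule metric_CauchyI)
    fix e :: real assume "0 < e"
    then obtain M where M: "4 / e\<^sup>2 < real M" using reals_Archimedean2 by blast
    have "dist (X i) (X j) < e" if "i \<ge> M" "j \<ge> M" for i j
    proof -
      have M0: "0 < real M" using \<open>0 < e\<close> by (intro less_trans[OF _ M]) simp
      have "2 / real (Suc i) \<le> 2 / real M" "2 / real (Suc j) \<le> 2 / real M"
        using that M0 by (auto intro!: divide_left_mono)
      moreover have "4 / real M < e\<^sup>2" using M M0 \<open>0 < e\<close> by (simp add: field_simps)
      ultimately have "(norm (X i - X j))\<^sup>2 < e\<^sup>2" using near[of i j] by simp
      then show ?thesis using \<open>0 < e\<close> by (simp add: dist_norm power_less_imp_less_base)
    qed
    then show "\<exists>M. \<forall>i\<ge>M. \<forall>j\<ge>M. dist (X i) (X j) < e" by blast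
  qed
  then obtain y where y: "X \<longlonglongrightarrow> y" by (meson Cauchy_convergent_iff convergent_def)
  have yL: "y \<in> L" using closed_sequentially[OF L(2) _ y] XL by blast
  have "(\<lambda>n. J (X n)) \<longlonglongrightarrow> J y" unfolding J_def by (intro tendsto_intros y)
  moreover have "(\<lambda>n. m + 1 / real (Suc n)) \<longlonglongrightarrow> m + 0"
    by (intro tendsto_intros LIMSEQ_Suc lim_1_over_n)
  ultimately have Jy: "J y \<le> m"
    using X by (intro LIMSEQ_le[of "\<lambda>n. J (X n)" _ "\<lambda>n. m + 1 / real (Suc n)"]) (auto intro: less_imp_le)
  have "inner (x - y) l = 0" if l: "l \<in> L" for l
  proof (cases "l = 0")
    case False
    define a where "a = inner (x - y) l"
    define t where "t = a / inner l l"
    have pos: "inner l l > 0" using False by simp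
    have "J y \<le> J (y + t *\<^sub>R l)"
      using Jy m_le[of "y + t *\<^sub>R l"] yL l L(1) by (simp add: subspace_add subspace_scale)
    then have "0 \<le> t * t * inner l l - 2 * t * a"
      by (simp add: J_def a_def power2_norm_eq_inner inner_simps inner_commute algebra_simps)
    also have "\<dots> = - (a * a) / inner l l" using pos by (simp add: t_def field_simps)
    finally have "a * a \<le> 0" using pos by (simp add: field_simps)
    then show ?thesis by (auto simp: mult_le_0_iff a_def)
  qed simp
  with yL show ?thesis by blast
qed

text \<open>The bounded operators form a Baer *-ring: the right annihilator of any set \<open>S\<close> is \<open>p B(H)\<close>, where
  \<open>p\<close> projects onto the common kernel of \<open>S\<close>. Obtaining projections in this form turns
  the commutation arguments below into computations in a ring.\<close>

lemma right_annihilator_projection: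
  fixes S :: "'h::chilbert_space bop set"
  shows "\<exists>p. p * p = p \<and> star p = p \<and> (\<forall>X. (\<forall>s\<in>S. s * X = 0) \<longleftrightarrow> p * X = X)"
proof -
  define L where "L = {x. \<forall>s\<in>S. bop_apply s x = 0}"
  have L_eq: "L = (\<Inter>s\<in>S. {x. bop_apply s x = 0})" by (auto simp: L_def)
  have cl: "closed L" unfolding L_eq by (intro closed_INT ballI closed_Collect_eq continuous_intros)
  have Lsub: "subspace L"
    by (auto simp: L_def subspace_def blinfun.bilinear_simps)
  have Lsc: "c *\<^sub>C x \<in> L" if "x \<in> L" for c x using that by (auto simp: L_def bop_apply_scaleC)
  obtain P where PL: "\<And>x. P x \<in> L" and Po: "\<And>x l. l \<in> L \<Longrightarrow> inner (x - P x) l = 0"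
    using exists_orthogonal_projection[OF Lsub cl] by metis
  \<comment> \<open>uniqueness of the nearest point is what makes \<open>P\<close> linear\<close>
  have uniq: "P x = y" if "y \<in> L" "\<And>l. l \<in> L \<Longrightarrow> inner (x - y) l = 0" for x y
  proof -
    have d: "P x - y \<in> L" using PL that(1) Lsub by (simp add: subspace_diff)
    have "inner (P x - y) (P x - y) = inner (x - y) (P x - y) - inner (x - P x) (P x - y)"
      by (simp add: inner_diff_left)
    also have "\<dots> = 0" using that(2)[OF d] Po[OF d] by simp
    finally show ?thesis by simp
  qed
  have Padd: "P (x + y) = P x + P y" for x y
  proof (rule uniq)
    show "P x + P y \<in> L" using PL Lsub by (simp add: subspace_add)
    fix l assume "l \<in> L"
    then show "inner (x + y - (P x + P y)) l = 0"
      using Po[of l x] Po[of l y] by (simp add: inner_simps)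
  qed
  have Psc: "P (c *\<^sub>C x) = c *\<^sub>C P x" for c x
  proof (rule uniq)
    show "c *\<^sub>C P x \<in> L" using PL Lsc by blast
    fix l assume l: "l \<in> L"
    have "inner (c *\<^sub>C x - c *\<^sub>C P x) l = inner (x - P x) (cnj c *\<^sub>C l)"
      by (simp add: inner_eq_Re_cinner complex_vector.scale_right_diff_distrib[symmetric]
          cinner_scaleC_left cinner_scaleC_right)
    then show "inner (c *\<^sub>C x - c *\<^sub>C P x) l = 0" using Po Lsc l by simp
  qed
  have pyth: "(norm x)\<^sup>2 = (norm (P x))\<^sup>2 + (norm (x - P x))\<^sup>2" for x
  proof -
    have "inner (P x) (x - P x) = 0" using Po[OF PL, of x x] by (simp add: inner_commute)
    then show ?thesis
      using dot_norm[of "P x" "x - P x"] by simp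
  qed
  have Pn: "norm (P x) \<le> norm x" for x
  proof (rule power2_le_imp_le)
    show "(norm (P x))\<^sup>2 \<le> (norm x)\<^sup>2"
      using pyth[of x] zero_le_power2[of "norm (x - P x)"] by linarith
  qed simp
  have "bounded_linear P"
    by (rule bounded_linear_intro[of _ 1]) (auto simp: Padd scaleR_scaleC Psc Pn)
  then have *: "blinfun_apply (Blinfun P) = P" by (rule bounded_linear_Blinfun_apply)
  define p where "p = Abs_bop (Blinfun P)"
  have p: "bop_apply p = P"
    unfolding p_def by (subst Abs_bop_inverse) (simp_all add: * Psc)
  have Pid: "P x = x" if "x \<in> L" for x using that by (intro uniq) auto
  have "p * p = p" by (rule bop_eqI) (simp add: bop_apply_simps p Pid PL)
  moreover have "star p = p"
  proof (rule star_bop_unique)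
    fix x y
    have i: "inner (P x) y = inner x (P y)" for x y
      using Po[OF PL, of x y] Po[OF PL, of y x] by (simp add: inner_diff_left inner_diff_right inner_commute)
    show "cinner (bop_apply p x) y = cinner x (bop_apply p y)"
    proof (rule complex_eqI)
      show "Re (cinner (bop_apply p x) y) = Re (cinner x (bop_apply p y))"
        using i[of x y] by (simp add: p inner_eq_Re_cinner)
      show "Im (cinner (bop_apply p x) y) = Im (cinner x (bop_apply p y))"
        using i[of x "\<i> *\<^sub>C y"] by (simp add: p Im_cinner Psc)
    qed
  qed
  moreover have "(\<forall>s\<in>S. s * X = 0) \<longleftrightarrow> p * X = X" for X
  proof
    assume S0: "\<forall>s\<in>S. s * X = 0"
    have "bop_apply s (bop_apply X x) = 0" if "s \<in> S" for s x
      using S0 that bop_apply_simps(5)[of s X x] by (simp add: bop_apply_simps(1))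
    then have "bop_apply X x \<in> L" for x by (simp add: L_def)
    then have "bop_apply (p * X) x = bop_apply X x" for x
      by (simp only: bop_apply_simps p Pid)
    then show "p * X = X" by (rule bop_eqI)
  next
    assume pX: "p * X = X"
    have "bop_apply X x \<in> L" for x
      using PL[of "bop_apply X x"] bop_apply_simps(5)[of p X x] by (simp add: p pX)
    then have "bop_apply (s * X) x = bop_apply 0 x" if "s \<in> S" for s x
      using that by (simp add: bop_apply_simps L_def)
    then show "\<forall>s\<in>S. s * X = 0" by (metis bop_eqI)
  qed
  ultimately show ?thesis by (intro exI[of _ p] conjI allI)
qed

section \<open>Commutants and von Neumann algebras\<close>

lemma closed_commutant: "closed (commutant S)"
proof -
  have "commutant S = (\<Inter>s\<in>S. {T. T * s = s * T})" by (auto simp: commutant_def)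
  then show ?thesis by (auto intro!: closed_INT closed_Collect_eq continuous_intros)
qed

lemma commutant_antimono: "S \<subseteq> T \<Longrightarrow> commutant T \<subseteq> commutant S"
  by (auto simp: commutant_def)

lemma bicommutant_mono: "S \<subseteq> T \<Longrightarrow> bicommutant S \<subseteq> bicommutant T"
  by (simp add: bicommutant_def commutant_antimono)

lemma subset_bicommutant: "S \<subseteq> bicommutant S"
  by (auto simp: bicommutant_def commutant_def)

lemma commutant_bicommutant [simp]: "commutant (bicommutant S) = commutant S"
  unfolding bicommutant_def using subset_bicommutant[of S] subset_bicommutant[of "commutant S"]
  by (metis bicommutant_def commutant_antimono subset_antisym)

lemma bicommutant_bicommutant [simp]: "bicommutant (bicommutant S) = bicommutant S"
  by (metis bicommutant_def commutant_bicommutant)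

lemma commutantD: "T \<in> commutant S \<Longrightarrow> s \<in> S \<Longrightarrow> T * s = s * T"
  by (simp add: commutant_def)

lemma commutantI: "(\<And>s. s \<in> S \<Longrightarrow> T * s = s * T) \<Longrightarrow> T \<in> commutant S"
  by (simp add: commutant_def)

lemma commutant_mult: "x \<in> commutant S \<Longrightarrow> y \<in> commutant S \<Longrightarrow> x * y \<in> commutant S"
  unfolding commutant_def by (auto simp: mult.assoc) (metis mult.assoc)

lemma subspace_commutant: "complex_vector.subspace (commutant S)"
  by (rule complex_vector.subspaceI)
    (auto simp: commutant_def distrib_left distrib_right mult_scaleC_left mult_scaleC_right)

lemma star_commutant:
  assumes S: "\<And>s. s \<in> S \<Longrightarrow> star s \<in> S" and T: "T \<in> commutant S"
  shows "star T \<in> commutant S"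
proof (rule commutantI)
  fix s assume "s \<in> S"
  then have "T * star s = star s * T" using S T by (blast intro: commutantD)
  then show "star T * s = s * star T" by (metis star_mult star_star)
qed

lemma star_subalgebra_commutant:
  assumes "\<And>s. s \<in> S \<Longrightarrow> star s \<in> S"
  shows "star_subalgebra (commutant S)"
  using assms by (auto simp: star_subalgebra_def subspace_commutant intro: commutant_mult star_commutant)

lemma von_neumann_algebra_bicommutant:
  assumes "\<And>s. s \<in> S \<Longrightarrow> star s \<in> S"
  shows "von_neumann_algebra (bicommutant S)"
  unfolding von_neumann_algebra_def
  using assms by (auto simp: bicommutant_def[of S] intro!: star_subalgebra_commutant star_commutant)
   (metis bicommutant_bicommutant bicommutant_def)+

lemma vna_closure_rules:
  assumes "von_neumann_algebra M"
  shows vna_add: "\<And>x y. x \<in> M \<Longrightarrow> y \<in> M \<Longrightarrow> x + y \<in> M"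
    and vna_diff: "\<And>x y. x \<in> M \<Longrightarrow> y \<in> M \<Longrightarrow> x - y \<in> M"
    and vna_mult: "\<And>x y. x \<in> M \<Longrightarrow> y \<in> M \<Longrightarrow> x * y \<in> M"
    and vna_star: "\<And>x. x \<in> M \<Longrightarrow> star x \<in> M"
    and vna_scaleC: "\<And>c x. x \<in> M \<Longrightarrow> c *\<^sub>C x \<in> M"
    and vna_scaleR: "\<And>r x. x \<in> M \<Longrightarrow> r *\<^sub>R x \<in> M"
    and vna_zero: "0 \<in> M"
    and vna_one: "1 \<in> M"
proof -
  have M: "complex_vector.subspace M" "\<And>x y. x \<in> M \<Longrightarrow> y \<in> M \<Longrightarrow> x * y \<in> M"
    "\<And>x. x \<in> M \<Longrightarrow> star x \<in> M" "bicommutant M = M"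
    using assms by (auto simp: von_neumann_algebra_def star_subalgebra_def)
  show "\<And>x y. x \<in> M \<Longrightarrow> y \<in> M \<Longrightarrow> x + y \<in> M" "\<And>x y. x \<in> M \<Longrightarrow> y \<in> M \<Longrightarrow> x - y \<in> M"
    "\<And>x y. x \<in> M \<Longrightarrow> y \<in> M \<Longrightarrow> x * y \<in> M" "\<And>x. x \<in> M \<Longrightarrow> star x \<in> M"
    "\<And>c x. x \<in> M \<Longrightarrow> c *\<^sub>C x \<in> M" "\<And>r x. x \<in> M \<Longrightarrow> r *\<^sub>R x \<in> M" "0 \<in> M"
    using M by (auto simp: scaleR_scaleC complex_vector.subspace_0
        intro: complex_vector.subspace_add complex_vector.subspace_diff complex_vector.subspace_scale)
  have "1 \<in> bicommutant M" by (simp add: bicommutant_def commutant_def)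
  then show "1 \<in> M" using M(4) by simp
qed

lemma vna_bicommutantD:
  assumes "von_neumann_algebra M" shows "bicommutant M = M"
  using assms by (simp add: von_neumann_algebra_def)

text \<open>The double commutant condition as a membership test. It is used below where approximation by
  elements of a generating algebra would be the usual route.\<close>

lemma vna_memI:
  assumes "von_neumann_algebra M" "\<And>S. S \<in> commutant M \<Longrightarrow> S * x = x * S"
  shows "x \<in> M"
proof -
  have "x \<in> bicommutant M" unfolding bicommutant_def
    by (rule commutantI) (simp add: assms(2))
  then show ?thesis using vna_bicommutantD[OF assms(1)] by simp
qed

text \<open>An algebraic form of the splitting into the kernel of \<open>a\<close> and the closure of its range: if \<open>X\<close> kills
  the range of \<open>a\<close> and whatever \<open>a\<close> kills, then \<open>X = 0\<close>. The witness is \<open>Y = X\<^sup>*\<close>, which gives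
  \<open>X X\<^sup>* = 0\<close>.\<close>

lemma self_adjoint_cancel:
  fixes a :: "'a::cstar_algebra"
  assumes "star a = a" "X * a = 0" "\<And>Y. a * Y = 0 \<Longrightarrow> X * Y = 0"
  shows "X = 0"
proof -
  have "a * star X = 0" by (metis assms(1,2) star_mult star_zero)
  then have "X * star X = 0" by (rule assms(3))
  then have "star X = 0" by (metis star_mult_self_eq_0 star_star)
  then show ?thesis by (metis star_star star_zero)
qed

text \<open>The operators \<open>z\<close> and \<open>z\<^sup>* z\<close> have the same kernel.\<close>

lemma star_mult_annihilates:
  fixes z :: "'a::cstar_algebra"
  assumes "star z * z * Y = 0" shows "z * Y = 0"
proof -
  have "star (z * Y) * (z * Y) = star Y * (star z * z * Y)" by (simp add: star_mult mult.assoc)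
  then show ?thesis using assms by (simp add: star_mult_self_eq_0)
qed

text \<open>Both \<open>k\<close> and \<open>k\<^sup>*\<close> leave the range of \<open>p\<close> invariant, so the range reduces \<open>k\<close>. For \<open>k\<close> ranging over
  a commutant this is how \<open>p\<close> is placed in a von Neumann algebra.\<close>

lemma annihilator_projection_commutes:
  fixes p :: "'h::chilbert_space bop"
  assumes p: "p * p = p" "star p = p" "\<And>X. (\<forall>s\<in>S. s * X = 0) \<longleftrightarrow> p * X = X"
    and k: "\<And>s. s \<in> S \<Longrightarrow> s * (k * p) = 0" "\<And>s. s \<in> S \<Longrightarrow> s * (star k * p) = 0"
  shows "k * p = p * k"
proof -
  have 1: "p * (k * p) = k * p" "p * (star k * p) = star k * p" using p(3) k by blast+
  have "star (p * (star k * p)) = star (star k * p)" using 1 by simp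
  then have "p * (k * p) = p * k" by (simp add: star_mult star_star p(2) mult.assoc)
  with 1 show ?thesis by simp
qed

section \<open>Sign decomposition and totality of projections\<close>

text \<open>Equality fails on the zero space, where \<open>1 = 0\<close>.\<close>

lemma norm_one_bop_le: "norm (1::'h::chilbert_space bop) \<le> 1"
  by (rule norm_bop_leI) (simp_all add: bop_apply_simps)

lemma symmetry_square:
  fixes p :: "'h::chilbert_space bop"
  assumes "p * p = p"
  shows "(p + p - 1) * (p + p - 1) = 1"
  by (simp add: distrib_left distrib_right left_diff_distrib right_diff_distrib assms)

lemma norm_symmetry_le:
  fixes p :: "'h::chilbert_space bop"
  assumes "p * p = p" "star p = p"
  shows "norm (p + p - 1) \<le> 1"
proof -
  have "star (p + p - 1) = p + p - 1" by (simp add: star_add star_diff assms)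
  then have "(norm (p + p - 1))\<^sup>2 = norm (1 :: 'h bop)"
    using norm_star_mult[of "p + p - 1"] symmetry_square[OF assms(1)] by simp
  then have "(norm (p + p - 1))\<^sup>2 \<le> 1\<^sup>2" using norm_one_bop_le[where 'h='h] by simp
  then show ?thesis by (rule power2_le_imp_le) simp
qed

lemma commutant_mult_singleton:
  assumes "k \<in> commutant {c}" shows "k \<in> commutant {c * c}"
proof -
  have "k * c = c * k" using assms by (simp add: commutant_def)
  then have "k * (c * c) = c * c * k" by (metis mult.assoc)
  then show ?thesis by (simp add: commutant_def)
qed

text \<open>The element \<open>a\<close> is an absolute value of \<open>c\<close>, written \<open>a = 1 - b\<close> with \<open>\<parallel>b\<parallel> \<le> 1\<close> and
  \<open>2 b = (1 - c\<^sup>2) + b\<^sup>2\<close>. The norm estimate replaces positivity: \<open>\<parallel>1 - a\<parallel> \<le> 1\<close> says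
  \<open>a\<^sup>2 \<le> 2 a\<close>, whence \<open>(a - 1/2)\<^sup>2 \<le> a\<^sup>2/2 + 1/4 \<le> 3/4\<close>, as \<open>a\<^sup>2 = c\<^sup>2 \<le> 1\<close>. Only \<open>3/4 < 1\<close> matters later.\<close>

lemma self_adjoint_abs_unit:
  fixes c :: "'h::chilbert_space bop"
  assumes c: "star c = c" "norm c \<le> 1"
  shows "\<exists>a\<in>bicommutant {c * c}. star a = a \<and> a * a = c * c \<and> norm (a - (1/2) *\<^sub>R 1) \<le> sqrt (3/4)"
proof -
  let ?B = "bicommutant {c * c} \<inter> {x. star x = x}"
  have vn: "von_neumann_algebra (bicommutant {c * c})"
    by (rule von_neumann_algebra_bicommutant) (simp add: c star_mult)
  note vnc = vna_closure_rules[OF vn]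
  have cc: "c * c \<in> bicommutant {c * c}" using subset_bicommutant by blast
  have norm_sq: "(norm (bop_apply x k))\<^sup>2 = inner (bop_apply (x * x) k) k" if "star x = x" for x :: "'h bop" and k
    using inner_star_left[of x "bop_apply x k" k] that by (simp add: power2_norm_eq_inner bop_apply_simps)
  have ck: "(norm (bop_apply c k))\<^sup>2 \<le> (norm k)\<^sup>2" for k
    using norm_bop_apply_le[of c k] mult_right_mono[OF c(2) norm_ge_zero[of k]] by (intro power_mono) auto
  define h where "h = 1 - c * c"
  have hs: "star h = h" by (simp add: h_def star_diff star_mult c)
  have "norm (bop_apply h k) \<le> 1 * norm k" for k
  proof -
    have "(norm (bop_apply h k))\<^sup>2 = (norm k)\<^sup>2 - 2 * inner k (bop_apply (c * c) k) + (norm (bop_apply (c * c) k))\<^sup>2"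
      by (simp add: h_def bop_apply_simps power2_norm_eq_inner inner_diff_left inner_diff_right inner_commute)
    also have "\<dots> = (norm k)\<^sup>2 - 2 * (norm (bop_apply c k))\<^sup>2 + (norm (bop_apply c (bop_apply c k)))\<^sup>2"
      using norm_sq[OF c(1), of k] by (simp add: inner_commute bop_apply_simps)
    also have "\<dots> \<le> (norm k)\<^sup>2" using ck[of "bop_apply c k"] zero_le_power2[of "norm (bop_apply c k)"] by linarith
    finally show ?thesis unfolding mult_1 by (rule power2_le_imp_le) simp
  qed
  then have hn: "norm h \<le> 1" by (rule norm_bop_leI[rotated]) simp
  have "closed ?B" unfolding bicommutant_def
    by (intro closed_Int closed_commutant closed_self_adjoint)
  moreover have "0 \<in> ?B" using vna_zero[OF vn] by simp
  moreover have "(1/2) *\<^sub>R (h + x * x) \<in> ?B" if "x \<in> ?B" for x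
  proof -
    have x: "x \<in> bicommutant {c * c}" "star x = x" using that by auto
    have "h \<in> bicommutant {c * c}" unfolding h_def by (intro vnc cc)
    then have "(1/2) *\<^sub>R (h + x * x) \<in> bicommutant {c * c}" by (intro vnc x)
    moreover have "star ((1/2) *\<^sub>R (h + x * x)) = (1/2) *\<^sub>R (h + x * x)"
      by (simp add: star_add star_mult star_scaleR hs x)
    ultimately show ?thesis by blast
  qed
  ultimately have "\<exists>b\<in>?B. norm b \<le> 1 \<and> b = (1/2) *\<^sub>R (h + b * b)"
    by (rule quadratic_iteration_fixed_point[OF hn])
  then obtain b where b: "b \<in> bicommutant {c * c}" "star b = b" "norm b \<le> 1" "b = (1/2) *\<^sub>R (h + b * b)"
    by blast
  have bb: "b + b = h + b * b"
    using arg_cong[OF b(4), of "\<lambda>x. x + x"] by (simp add: scaleR_add_left[symmetric])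
  define a where "a = 1 - b"
  have "a * a = 1 - (b + b) + b * b" by (simp add: a_def algebra_simps)
  then have aa: "a * a = c * c" by (simp add: bb h_def)
  have as: "star a = a" by (simp add: a_def star_diff b(2))
  have "norm (bop_apply (a - (1/2) *\<^sub>R 1) k) \<le> sqrt (3/4) * norm k" for k
  proof -
    have bk: "(norm (bop_apply b k))\<^sup>2 \<le> (norm k)\<^sup>2"
      using norm_bop_apply_le[of b k] mult_right_mono[OF b(3) norm_ge_zero[of k]] by (intro power_mono) auto
    have "bop_apply b k = k - bop_apply a k" by (simp add: a_def bop_apply_simps)
    then have "(norm (bop_apply b k))\<^sup>2 = (norm k)\<^sup>2 - 2 * inner (bop_apply a k) k + (norm (bop_apply a k))\<^sup>2"
      by (simp add: power2_norm_eq_inner inner_diff_left inner_diff_right inner_commute)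
    with bk have 1: "(norm (bop_apply a k))\<^sup>2 \<le> 2 * inner (bop_apply a k) k" by linarith
    have 2: "(norm (bop_apply a k))\<^sup>2 \<le> (norm k)\<^sup>2"
      using ck[of k] norm_sq[OF as] norm_sq[OF c(1)] aa by simp
    have "(norm (bop_apply (a - (1/2) *\<^sub>R 1) k))\<^sup>2
      = (norm (bop_apply a k))\<^sup>2 - inner (bop_apply a k) k + (1/4) * (norm k)\<^sup>2"
      by (simp add: bop_apply_simps bop_apply_scaleR power2_norm_eq_inner inner_simps inner_commute algebra_simps)
    also have "\<dots> \<le> 3/4 * (norm k)\<^sup>2" using 1 2 by linarith
    also have "\<dots> = (sqrt (3/4) * norm k)\<^sup>2" by (simp add: power_mult_distrib)
    finally show ?thesis by (rule power2_le_imp_le) simp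
  qed
  then have "norm (a - (1/2) *\<^sub>R 1) \<le> sqrt (3/4)" by (rule norm_bop_leI[rotated]) simp
  moreover have "a \<in> bicommutant {c * c}" unfolding a_def by (intro vnc b(1))
  ultimately show ?thesis using as aa by blast
qed

text \<open>The same without normalization. The bicommutant of \<open>c\<^sup>2\<close>, rather than of \<open>c\<close>, is essential: below,
  \<open>c\<^sup>2\<close> lies in an abelian algebra to which \<open>c\<close> need not belong.\<close>

lemma self_adjoint_abs:
  fixes c :: "'h::chilbert_space bop"
  assumes c: "star c = c"
  shows "\<exists>a\<in>bicommutant {c * c}. star a = a \<and> a * a = c * c \<and>
    norm (a - (norm c / 2) *\<^sub>R 1) \<le> sqrt (3/4) * norm c"
proof (cases "c = 0")
  case True
  have "0 \<in> bicommutant {c * c}" by (simp add: bicommutant_def commutant_def)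
  then show ?thesis using True by (intro bexI[of _ 0]) auto
next
  case False
  define K where "K = norm c"
  have K: "K > 0" using False by (simp add: K_def)
  define c' where "c' = (1/K) *\<^sub>R c"
  have c'c: "c = K *\<^sub>R c'" using K by (simp add: c'_def)
  have "star c' = c'" "norm c' \<le> 1" using K by (auto simp: c'_def star_scaleR c) (simp add: K_def)
  then obtain a where a: "a \<in> bicommutant {c' * c'}" "star a = a" "a * a = c' * c'"
      "norm (a - (1/2) *\<^sub>R 1) \<le> sqrt (3/4)"
    using self_adjoint_abs_unit by blast
  have "commutant {c * c} \<subseteq> commutant {c' * c'}" by (auto simp: commutant_def c'_def)
  then have "a \<in> bicommutant {c * c}" using a(1) by (auto simp: bicommutant_def dest: commutant_antimono)
  then have "K *\<^sub>R a \<in> bicommutant {c * c}" by (auto simp: bicommutant_def commutant_def)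
  moreover have "norm (K *\<^sub>R a - (K / 2) *\<^sub>R 1) \<le> sqrt (3/4) * K"
  proof -
    have "K *\<^sub>R a - (K / 2) *\<^sub>R 1 = K *\<^sub>R (a - (1/2) *\<^sub>R 1)" by (simp add: scaleR_diff_right)
    then have "norm (K *\<^sub>R a - (K / 2) *\<^sub>R 1) = K * norm (a - (1/2) *\<^sub>R 1)" using K by simp
    also have "\<dots> \<le> K * sqrt (3/4)" by (rule mult_left_mono) (use a(4) K in auto)
    finally show ?thesis by (simp add: mult.commute)
  qed
  moreover have "(K *\<^sub>R a) * (K *\<^sub>R a) = c * c" by (simp add: c'c a(3))
  ultimately show ?thesis unfolding K_def[symmetric]
    by (intro bexI[of _ "K *\<^sub>R a"]) (auto simp: star_scaleR a(2))
qed

text \<open>Polar decomposition \<open>c = s a\<close> of a self-adjoint element, with the symmetry \<open>s = 2 p - 1\<close>. Here \<open>p\<close> is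
  the projection onto the kernel of \<open>a - c\<close>. As \<open>(a - c) (a + c) = a\<^sup>2 - c\<^sup>2 = 0\<close>, this kernel contains
  the range of \<open>a + c\<close>, so \<open>c = a\<close> on it and \<open>c = -a\<close> on its complement. The choice \<open>s = 1\<close> on the
  kernel of \<open>c\<close> makes \<open>s\<close> a unitary, not merely a partial isometry.\<close>

lemma sign_decomposition:
  fixes c :: "'h::chilbert_space bop"
  assumes c: "star c = c"
  shows "\<exists>p a. p \<in> bicommutant {c} \<and> p * p = p \<and> star p = p \<and> a \<in> bicommutant {c * c} \<and> star a = a \<and>
    a * a = c * c \<and> c = (p + p - 1) * a \<and> c = a * (p + p - 1) \<and>
    norm (a - (norm c / 2) *\<^sub>R 1) \<le> sqrt (3/4) * norm c \<and> (\<forall>Y. c * Y = 0 \<longrightarrow> p * Y = Y)"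
proof -
  obtain a where a: "a \<in> bicommutant {c * c}" "star a = a" "a * a = c * c"
    "norm (a - (norm c / 2) *\<^sub>R 1) \<le> sqrt (3/4) * norm c"
    using self_adjoint_abs[OF c] by blast
  obtain p where p: "p * p = p" "star p = p" "\<And>X. (\<forall>s\<in>{a - c}. s * X = 0) \<longleftrightarrow> p * X = X"
    using right_annihilator_projection[of "{a - c}"] by blast
  have c_comm: "c \<in> commutant {c}" by (simp add: commutant_def)
  have a_comm: "a * k = k * a" if "k \<in> commutant {c}" for k
    using a(1) commutant_mult_singleton[OF that] by (auto simp: bicommutant_def dest: commutantD)
  have ac: "a * c = c * a" by (rule a_comm[OF c_comm])
  have pX: "p * X = X \<longleftrightarrow> (a - c) * X = 0" for X using p(3)[of X] by simp
  have kill: "(a - c) * (k * p) = 0" if "k \<in> commutant {c}" for k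
  proof -
    have "k * c = c * k" "a * k = k * a" using that a_comm by (auto simp: commutant_def)
    then have "(a - c) * k = k * (a - c)" by (simp add: left_diff_distrib right_diff_distrib)
    then have "(a - c) * (k * p) = k * ((a - c) * p)" by (simp add: mult.assoc[symmetric])
    also have "(a - c) * p = 0" using pX p(1) by blast
    finally show ?thesis by simp
  qed
  have "p \<in> bicommutant {c}" unfolding bicommutant_def
  proof (rule commutantI)
    fix k assume k: "k \<in> commutant {c}"
    then have "star k \<in> commutant {c}" by (rule star_commutant[rotated]) (simp add: c)
    then have "k * p = p * k"
      using k kill by (intro annihilator_projection_commutes[OF p]) auto
    then show "p * k = k * p" by simp
  qed
  have "(a - c) * (a + c) = 0" by (simp add: distrib_left left_diff_distrib a(3) ac)
  then have 1: "p * (a + c) = a + c" by (simp add: pX)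
  from pX p(1) have "(a - c) * p = 0" by blast
  then have "star ((a - c) * p) = 0" by simp
  then have 2: "p * (a - c) = 0" by (simp add: star_mult star_diff a c p)
  have "p * c + p * c = p * (a + c) - p * (a - c)" by (simp add: distrib_left right_diff_distrib)
  then have sc: "(p + p - 1) * c = a" by (simp add: 1 2 distrib_right left_diff_distrib)
  then have "star ((p + p - 1) * c) = a" by (simp add: a(2))
  then have cs: "c * (p + p - 1) = a" by (simp add: star_mult star_diff star_add p(2) c)
  have "c = (p + p - 1) * a" using symmetry_square[OF p(1)] by (metis sc mult.assoc mult_1)
  moreover have "c = a * (p + p - 1)" using symmetry_square[OF p(1)] by (metis cs mult.assoc mult_1_right)
  moreover have "p * Y = Y" if cY: "c * Y = 0" for Y
  proof -
    have "star a * a * Y = 0" using cY by (simp only: a(2,3) mult.assoc mult_zero_right)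
    then have "a * Y = 0" by (rule star_mult_annihilates)
    with cY have "(a - c) * Y = 0" by (simp only: left_diff_distrib diff_self)
    then show ?thesis by (simp only: pX)
  qed
  ultimately show ?thesis
    by (intro exI[of _ p] exI[of _ a] conjI allI impI a p(1,2) \<open>p \<in> bicommutant {c}\<close>)
qed

lemma bicommutant_singleton_subset:
  assumes "von_neumann_algebra M" "c \<in> M"
  shows "bicommutant {c} \<subseteq> M"
  using bicommutant_mono[of "{c}" M] assms vna_bicommutantD by auto

text \<open>A von Neumann algebra is the closed span of its projections. By the sign decomposition every
  self-adjoint \<open>c\<close> differs from a multiple of a symmetry, \<open>\<parallel>c\<parallel>/2\<close> times \<open>s\<close>, by \<open>s (a - \<parallel>c\<parallel>/2)\<close>,
  whose norm is at most \<open>sqrt (3/4)\<close> times \<open>\<parallel>c\<parallel>\<close>; iterating, the remainder tends to \<open>0\<close>. This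
  takes the place of spectral integrals.\<close>

lemma projections_total:
  fixes M :: "'h::chilbert_space bop set"
  assumes M: "von_neumann_algebra M" and V: "complex_vector.subspace V" "closed V"
    and P: "projections M \<subseteq> V"
  shows "M \<subseteq> V"
proof -
  note Mc = vna_closure_rules[OF M]
  have VR: "r *\<^sub>R x \<in> V" if "x \<in> V" for r x
    using that V(1) by (simp add: scaleR_scaleC complex_vector.subspace_scale)
  have oneV: "1 \<in> V" using P Mc by (auto simp: projections_def)
  define \<rho> where "\<rho> = sqrt (3/4)"
  have "sqrt (3/4) < sqrt 1" by (rule real_sqrt_less_mono) simp
  then have \<rho>: "0 \<le> \<rho>" "\<rho> < 1" by (simp_all add: \<rho>_def)
  have approx: "\<exists>v\<in>V. c - v \<in> M \<and> star (c - v) = c - v \<and> norm (c - v) \<le> \<rho> * norm c"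
    if c: "c \<in> M" "star c = c" for c
  proof -
    obtain p a where p: "p \<in> bicommutant {c}" "p * p = p" "star p = p" "a \<in> bicommutant {c * c}" "star a = a"
      "c = (p + p - 1) * a" and n: "norm (a - (norm c / 2) *\<^sub>R 1) \<le> \<rho> * norm c"
      using sign_decomposition[OF c(2)] unfolding \<rho>_def by blast
    let ?s = "p + p - 1" and ?v = "(norm c / 2) *\<^sub>R (p + p - 1)"
    have pM: "p \<in> M" using p(1) bicommutant_singleton_subset[OF M c(1)] by blast
    then have "p \<in> V" using p P by (auto simp: projections_def)
    then have "?v \<in> V"
      using V(1) oneV by (intro VR complex_vector.subspace_diff complex_vector.subspace_add)
    moreover have "c - ?v \<in> M" by (intro Mc c pM)
    moreover have "star (c - ?v) = c - ?v" by (simp add: star_diff star_add star_scaleR c(2) p(3))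
    moreover have "c - ?v = ?s * (a - (norm c / 2) *\<^sub>R 1)"
      by (subst p(6)) (simp add: right_diff_distrib)
    then have "norm (c - ?v) \<le> norm ?s * norm (a - (norm c / 2) *\<^sub>R 1)"
      by (simp only: norm_mult_ineq)
    then have "norm (c - ?v) \<le> \<rho> * norm c"
      using n mult_right_mono[OF norm_symmetry_le[OF p(2,3)], of "norm (a - (norm c / 2) *\<^sub>R 1)"] by simp
    ultimately show ?thesis by blast
  qed
  have iter: "\<exists>v\<in>V. c - v \<in> M \<and> star (c - v) = c - v \<and> norm (c - v) \<le> \<rho> ^ n * norm c"
    if c: "c \<in> M" "star c = c" for c n
  proof (induction n)
    case 0
    then show ?case using c V(1) by (intro bexI[of _ 0]) (auto simp: complex_vector.subspace_0)
  next
    case (Suc n)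
    then obtain v where v: "v \<in> V" "c - v \<in> M" "star (c - v) = c - v" "norm (c - v) \<le> \<rho> ^ n * norm c" by blast
    from approx[OF v(2,3)] obtain v' where v': "v' \<in> V" "c - v - v' \<in> M" "star (c - v - v') = c - v - v'"
      "norm (c - v - v') \<le> \<rho> * norm (c - v)" by blast
    have "norm (c - v - v') \<le> \<rho> ^ Suc n * norm c"
      using v'(4) mult_left_mono[OF v(4) \<rho>(1)] by (simp add: mult.assoc)
    with v v' show ?case using V(1) by (intro bexI[of _ "v + v'"])
      (auto simp: diff_diff_eq complex_vector.subspace_add)
  qed
  have sa: "c \<in> V" if c: "c \<in> M" "star c = c" for c
  proof -
    have "\<exists>v\<in>V. dist v c < e" if "e > 0" for e
    proof -
      have "(\<lambda>n. \<rho> ^ n * norm c) \<longlonglongrightarrow> 0 * norm c"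
        using \<rho> by (intro tendsto_intros LIMSEQ_power_zero) simp
      then have "\<forall>\<^sub>F n in sequentially. \<rho> ^ n * norm c < e" using that by (simp add: order_tendstoD)
      then obtain n where "\<rho> ^ n * norm c < e" by (auto simp: eventually_sequentially)
      with iter[OF c, of n] show ?thesis by (auto simp: dist_norm norm_minus_commute intro: le_less_trans)
    qed
    then have "c \<in> closure V" by (auto simp: closure_approachable)
    with V(2) show ?thesis by simp
  qed
  show ?thesis
  proof
    fix c assume c: "c \<in> M"
    define x y where "x = c + star c" and "y = \<i> *\<^sub>C (c - star c)"
    have xV: "x \<in> V" unfolding x_def by (intro sa Mc c) (simp add: star_add star_star add.commute)
    have yV: "y \<in> V" unfolding y_def
      by (intro sa Mc c) (simp add: star_scaleC star_diff star_star complex_vector.scale_right_diff_distrib)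
    have c_eq: "c = (1/2) *\<^sub>C (x + (- \<i>) *\<^sub>C y)"
    proof -
      have "x + (- \<i>) *\<^sub>C y = c + c" by (simp add: x_def y_def scaleC_scaleC scaleC_one)
      also have "\<dots> = 2 *\<^sub>C c" using scaleC_add_left[of 1 1 c] by (simp add: scaleC_one)
      finally show ?thesis by (simp add: scaleC_scaleC scaleC_one)
    qed
    show "c \<in> V" by (subst c_eq)
      (intro complex_vector.subspace_scale complex_vector.subspace_add V(1) xV yV)
  qed
qed

lemma commute_projections_imp_commutant:
  assumes "von_neumann_algebra M" "\<And>p. p \<in> projections M \<Longrightarrow> T * p = p * T"
  shows "T \<in> commutant M"
proof -
  have "M \<subseteq> commutant {T}"
    by (rule projections_total[OF assms(1) subspace_commutant closed_commutant])
      (auto simp: commutant_def assms(2))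
  then show ?thesis by (auto simp: commutant_def)
qed

section \<open>Conjugation by normalizing elements\<close>

text \<open>Conjugation by \<open>z\<close> passes from \<open>D\<close> to its double commutant. For \<open>S\<close> in the commutant of \<open>D\<close>, the
  operator \<open>R = z\<^sup>* S z\<close> again commutes with \<open>D\<close>: this holds after multiplication by \<open>a = z\<^sup>* z\<close>, because
  \<open>z d a = (z d z\<^sup>*) z\<close>, and on the kernel of \<open>a\<close> everything vanishes. Hence \<open>c\<close> commutes with \<open>R\<close>,
  and the same cancellation with \<open>b = z z\<^sup>*\<close> turns this into a commutation of \<open>z c z\<^sup>*\<close> with \<open>S\<close>.
  The hypotheses that \<open>a\<close> and \<open>b\<close> lie in \<open>D\<close> stand in for a unit of \<open>D\<close>.\<close>

lemma conjugate_mem_bicommutant: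
  fixes D :: "'h::chilbert_space bop set"
  assumes D: "abelian D" and zD: "\<And>d. d \<in> D \<Longrightarrow> z * d * star z \<in> D"
    and aD: "star z * z \<in> D" and bD: "z * star z \<in> D" and c: "c \<in> bicommutant D"
  shows "z * c * star z \<in> bicommutant D"
  unfolding bicommutant_def
proof (rule commutantI)
  fix S assume S: "S \<in> commutant D"
  define a b R where "a = star z * z" and "b = z * star z" and "R = star z * S * z"
  have sa: "star a = a" and sb: "star b = b" by (simp_all add: a_def b_def star_mult star_star)
  have za: "z * Y = 0" if "a * Y = 0" for Y
    using that star_mult_annihilates[of z Y] by (simp add: a_def)
  have zb: "star z * Y = 0" if "b * Y = 0" for Y
    using that star_mult_annihilates[of "star z" Y] by (simp add: b_def star_star)
  have Sb: "S * b = b * S" using S bD unfolding b_def by (rule commutantD)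
  have R: "R \<in> commutant D"
  proof (rule commutantI)
    fix d assume d: "d \<in> D"
    have ad: "a * d = d * a" using D d aD by (simp add: abelian_def a_def)
    have "R * a = star z * (S * b) * z" by (simp add: R_def a_def b_def mult.assoc)
    also have "\<dots> = a * R" unfolding Sb by (simp add: R_def a_def b_def mult.assoc)
    finally have Ra: "R * a = a * R" .
    have "R * d * a = star z * (S * (z * d * star z)) * z" by (simp add: R_def a_def mult.assoc)
    also have "S * (z * d * star z) = (z * d * star z) * S" by (rule commutantD[OF S zD[OF d]])
    also have "star z * \<dots> * z = a * d * R" by (simp add: R_def a_def mult.assoc)
    finally have Rda: "R * d * a = a * d * R" .
    have "R * d - d * R = 0"
    proof (rule self_adjoint_cancel[OF sa])
      have "(R * d - d * R) * a = R * d * a - d * (R * a)"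
        by (simp only: left_diff_distrib mult.assoc)
      also have "\<dots> = a * d * R - d * a * R" unfolding Rda Ra by (simp only: mult.assoc)
      also have "\<dots> = 0" by (simp only: ad diff_self)
      finally show "(R * d - d * R) * a = 0" .
      fix Y assume Y: "a * Y = 0"
      have RY: "R * Y' = 0" if "a * Y' = 0" for Y' using za[OF that] by (simp add: R_def mult.assoc)
      have "a * (d * Y) = d * (a * Y)" by (simp only: mult.assoc[symmetric] ad)
      then have "a * (d * Y) = 0" by (simp add: Y)
      then have "R * (d * Y) = 0" by (rule RY)
      with RY[OF Y] show "(R * d - d * R) * Y = 0" by (simp add: left_diff_distrib mult.assoc)
    qed
    then show "R * d = d * R" by simp
  qed
  have aD': "a \<in> commutant D" using D aD by (auto simp: commutant_def abelian_def a_def)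
  have ca: "c * a = a * c" and cR: "c * R = R * c"
    using c aD' R by (auto simp: bicommutant_def intro: commutantD)
  define K where "K = z * c * star z"
  have "b * K = z * (a * c) * star z" by (simp add: K_def a_def b_def mult.assoc)
  also have "\<dots> = K * b" unfolding ca[symmetric] by (simp add: K_def a_def b_def mult.assoc)
  finally have bK: "b * K = K * b" .
  have "K * S * b = z * (c * R) * star z" by (simp add: K_def R_def b_def mult.assoc)
  also have "\<dots> = b * S * K" unfolding cR by (simp add: K_def R_def b_def mult.assoc)
  also have "\<dots> = S * (b * K)" by (simp only: Sb[symmetric] mult.assoc)
  finally have KSb: "K * S * b = S * K * b" by (simp only: bK mult.assoc)
  have "K * S - S * K = 0"
  proof (rule self_adjoint_cancel[OF sb])
    show "(K * S - S * K) * b = 0" by (simp only: left_diff_distrib KSb diff_self)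
    fix Y assume Y: "b * Y = 0"
    have KY: "K * Y' = 0" if "b * Y' = 0" for Y' using zb[OF that] by (simp add: K_def mult.assoc)
    have "b * (S * Y) = S * (b * Y)" by (simp only: mult.assoc[symmetric] Sb)
    then have "K * (S * Y) = 0" using Y by (intro KY) simp
    with KY[OF Y] show "(K * S - S * K) * Y = 0" by (simp add: left_diff_distrib mult.assoc)
  qed
  then show "z * c * star z * S = S * (z * c * star z)" by (simp add: K_def)
qed

text \<open>The unitary part of a self-adjoint normalizing element normalizes. Since \<open>a\<close> lies in \<open>N\<close> and
  \<open>a (s n s) a = w n w\<close>, the element \<open>s n s\<close> behaves like an element of \<open>N\<close> on the range of
  \<open>a\<close>; on the kernel of \<open>w\<close>, where \<open>s\<close> is the identity, it agrees with \<open>n\<close>.\<close>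

lemma sign_normalizes:
  fixes N :: "'h::chilbert_space bop set"
  assumes N: "von_neumann_algebra N" "abelian N"
    and w: "star w = w" "w * w \<in> N" "\<And>n. n \<in> N \<Longrightarrow> w * n * w \<in> N"
  shows "\<exists>p a. p \<in> bicommutant {w} \<and> p * p = p \<and> star p = p \<and> a \<in> N \<and> w = (p + p - 1) * a \<and>
    (\<forall>n\<in>N. (p + p - 1) * n * (p + p - 1) \<in> N)"
proof -
  have NN: "x * y = y * x" if "x \<in> N" "y \<in> N" for x y using N(2) that by (simp add: abelian_def)
  obtain p a where p: "p \<in> bicommutant {w}" "p * p = p" "star p = p"
    and a: "a \<in> bicommutant {w * w}" "star a = a" "a * a = w * w"
    and wa: "w = (p + p - 1) * a" "w = a * (p + p - 1)"
    and pY: "\<And>Y. w * Y = 0 \<Longrightarrow> p * Y = Y"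
    using sign_decomposition[OF w(1)] by blast
  have aN: "a \<in> N" using a(1) bicommutant_singleton_subset[OF N(1) w(2)] by blast
  define s where "s = p + p - 1"
  have s: "s * a = w" "a * s = w" using wa by (simp_all only: s_def)
  have sY: "s * Y = Y" if "w * Y = 0" for Y
    using pY[OF that] by (simp add: s_def left_diff_distrib distrib_right)
  have wY: "w * Y = 0" if "w * w * Y = 0" for Y
    using that star_mult_annihilates[of w Y] by (simp add: w(1))
  have "s * n * s \<in> N" if n: "n \<in> N" for n
  proof (rule vna_memI[OF N(1)])
    fix S assume S: "S \<in> commutant N"
    define K where "K = s * n * s"
    have Sa: "S * a = a * S" by (rule commutantD[OF S aN])
    have Sn: "S * n = n * S" by (rule commutantD[OF S n])
    have Sww: "S * (w * w) = w * w * S" by (rule commutantD[OF S w(2)])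
    have "K * a = s * n * (s * a)" by (simp only: K_def mult.assoc)
    also have "\<dots> = s * (n * a) * s" by (simp only: s(1) s(2)[symmetric] mult.assoc)
    also have "\<dots> = (s * a) * n * s" by (simp only: NN[OF n aN] mult.assoc)
    also have "\<dots> = a * K" by (simp only: s(1) s(2)[symmetric] mult.assoc K_def)
    finally have Ka: "K * a = a * K" .
    have "a * K * a = (a * s) * n * (s * a)" by (simp only: K_def mult.assoc)
    also have "\<dots> = w * n * w" by (simp only: s)
    finally have aKa: "a * K * a \<in> N" using w(3)[OF n] by simp
    have "a * S * K * a = S * (a * K * a)" by (simp only: Sa[symmetric] mult.assoc)
    also have "\<dots> = (a * K * a) * S" by (rule commutantD[OF S aKa])
    also have "\<dots> = a * K * S * a" by (simp only: Sa mult.assoc)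
    finally have aSKa: "a * S * K * a = a * K * S * a" .
    have "S * K - K * S = 0"
    proof (rule self_adjoint_cancel)
      show "star (w * w) = w * w" by (simp add: star_mult w(1))
      have "S * K * (w * w) = S * (K * a) * a" by (simp only: a(3)[symmetric] mult.assoc)
      also have "\<dots> = (S * a) * K * a" by (simp only: Ka mult.assoc)
      also have "\<dots> = a * K * S * a" by (simp only: Sa aSKa)
      also have "\<dots> = K * (a * S) * a" by (simp only: Ka[symmetric] mult.assoc)
      also have "\<dots> = K * S * (w * w)" by (simp only: Sa[symmetric] a(3)[symmetric] mult.assoc)
      finally show "(S * K - K * S) * (w * w) = 0" by (simp add: left_diff_distrib)
      fix Y assume Y: "w * w * Y = 0"
      have KY: "K * Y' = n * Y'" if Y': "w * w * Y' = 0" for Y'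
      proof -
        have "w * w * (n * Y') = n * (w * w * Y')"
          using NN[OF n w(2)] by (metis mult.assoc)
        then have "w * (n * Y') = 0" using Y' by (intro wY) simp
        then have "s * (n * Y') = n * Y'" by (rule sY)
        moreover have "s * Y' = Y'" by (rule sY[OF wY[OF Y']])
        ultimately show ?thesis by (simp add: K_def mult.assoc)
      qed
      have "w * w * (S * Y) = S * (w * w * Y)" using Sww by (metis mult.assoc)
      then have "K * (S * Y) = n * (S * Y)" using Y by (intro KY) simp
      then show "(S * K - K * S) * Y = 0"
        using KY[OF Y] Sn by (simp add: left_diff_distrib mult.assoc) (metis mult.assoc diff_self)
    qed
    then show "S * (s * n * s) = s * n * s * S" by (simp add: K_def)
  qed
  then show ?thesis using p aN wa(1) unfolding s_def by blast
qed

section \<open>From normalizing elements to normalizing unitaries\<close>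

lemma von_neumann_algebra_commutant:
  assumes "\<And>s. s \<in> S \<Longrightarrow> star s \<in> S"
  shows "von_neumann_algebra (commutant S)"
  unfolding von_neumann_algebra_def
  using star_subalgebra_commutant[OF assms] commutant_bicommutant[of S] by (simp add: bicommutant_def)

lemma von_neumann_algebra_Int_commutant:
  assumes M: "von_neumann_algebra M" and N: "von_neumann_algebra N"
  shows "von_neumann_algebra (M \<inter> commutant N)"
proof -
  have "M \<inter> commutant N = bicommutant M \<inter> commutant N" using vna_bicommutantD[OF M] by simp
  also have "\<dots> = commutant (commutant M \<union> N)" by (auto simp: bicommutant_def commutant_def)
  finally show ?thesis
    using vna_star[OF M] vna_star[OF N]
    by (auto intro!: von_neumann_algebra_commutant intro: star_commutant)
qed

lemma symmetry_in_vn_normalizer: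
  assumes M: "von_neumann_algebra M" and p: "p \<in> M" "p * p = p" "star p = p"
    and N: "\<And>n. n \<in> N \<Longrightarrow> (p + p - 1) * n * (p + p - 1) \<in> N"
  shows "p + p - 1 \<in> vn_normalizer M N"
proof -
  define s where "s = p + p - 1"
  have ss: "s * s = 1" unfolding s_def by (rule symmetry_square[OF p(2)])
  have star_s: "star s = s" by (simp add: s_def star_add star_diff p)
  have "s \<in> M" unfolding s_def by (intro vna_closure_rules[OF M] p)
  moreover have "N \<subseteq> (\<lambda>x. s * x * s) ` N"
  proof
    fix n assume n: "n \<in> N"
    have "s * (s * n * s) * s = s * s * n * (s * s)" by (simp only: mult.assoc)
    then have "n = s * (s * n * s) * s" by (simp add: ss)
    then show "n \<in> (\<lambda>x. s * x * s) ` N" using N[OF n] unfolding s_def by blast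
  qed
  ultimately show ?thesis
    using N unfolding s_def[symmetric]
    by (auto simp: vn_normalizer_def unitaries_def star_s ss)
qed

text \<open>The symmetries of \<open>M \<inter> N'\<close> fix \<open>N\<close> elementwise, so they belong to the normalizer, and they
  span a dense subspace of \<open>M \<inter> N'\<close> because the projections do.\<close>

lemma commutant_vn_normalizer_commutes:
  assumes M: "von_neumann_algebra M" and N: "von_neumann_algebra N"
    and T: "T \<in> commutant (vn_normalizer M N)" and x: "x \<in> M" "x \<in> commutant N"
  shows "T * x = x * T"
proof -
  let ?B = "M \<inter> commutant N"
  have B: "von_neumann_algebra ?B" by (rule von_neumann_algebra_Int_commutant[OF M N])
  have "T \<in> commutant ?B"
  proof (rule commute_projections_imp_commutant[OF B])
    fix p assume "p \<in> projections ?B"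
    then have p: "p \<in> ?B" "p * p = p" "star p = p" by (auto simp: projections_def)
    let ?s = "p + p - 1"
    have sB: "?s \<in> ?B" by (intro vna_closure_rules[OF B] p)
    have "?s \<in> vn_normalizer M N"
    proof (rule symmetry_in_vn_normalizer[OF M])
      fix n assume n: "n \<in> N"
      have "?s * n = n * ?s" using sB n by (blast intro: commutantD)
      then have "?s * n * ?s = n" using symmetry_square[OF p(2)] by (simp only: mult.assoc mult_1_right)
      with n show "?s * n * ?s \<in> N" by simp
    qed (use p in auto)
    then have "T * ?s = ?s * T" by (rule commutantD[OF T])
    then have "T * p + T * p = p * T + p * T"
      by (simp add: right_diff_distrib left_diff_distrib distrib_left distrib_right)
    then have "(2::real) *\<^sub>R (T * p) = 2 *\<^sub>R (p * T)" by (simp add: scaleR_2)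
    then show "T * p = p * T" by simp
  qed
  then show ?thesis using x by (auto intro: commutantD)
qed

text \<open>An off-diagonal corner \<open>q z r\<close> has square zero, so its self-adjoint version \<open>w = q z r + (q z r)\<^sup>*\<close>
  still normalizes \<open>N\<close>: in \<open>w n w\<close> the terms with \<open>r n q\<close> or \<open>q n r\<close> drop out. Then \<open>w = s a\<close> with
  \<open>s\<close> in the unitary normalizer and \<open>a\<close> in \<open>N\<close>, and \<open>T\<close> commutes with both. Geometrically, \<open>w\<close> swaps
  subsets of two disjoint parts of the spectrum of \<open>N\<close>.\<close>

lemma commutant_vn_normalizer_corner:
  assumes M: "von_neumann_algebra M" and N: "von_neumann_algebra N" "abelian N" "N \<subseteq> M"
    and z: "z \<in> M" "\<And>n. n \<in> N \<Longrightarrow> z * n * star z \<in> N" "\<And>n. n \<in> N \<Longrightarrow> star z * n * z \<in> N"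
    and T: "T \<in> commutant (vn_normalizer M N)"
    and q: "q \<in> N" "r \<in> N" "star q = q" "star r = r" "q * q = q" "r * r = r" "q * r = 0"
  shows "T * (q * z * r) = q * z * r * T"
proof -
  have NN: "x * y = y * x" if "x \<in> N" "y \<in> N" for x y using N(2) that by (simp add: abelian_def)
  have rq: "r * q = 0" using NN[OF q(1,2)] q(7) by simp
  note Nc = vna_closure_rules[OF N(1)] and Mc = vna_closure_rules[OF M]
  define w where "w = q * z * r + r * star z * q"
  have w_sa: "star w = w" by (simp add: w_def star_add star_mult star_star q mult.assoc add.commute)
  have wM: "w \<in> M" unfolding w_def using q N(3) by (intro Mc z(1)) auto
  have wnw: "w * n * w \<in> N" if n: "n \<in> N" for n
  proof -
    have rnq: "r * (n * (q * x)) = 0" for x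
    proof -
      have "r * (n * (q * x)) = n * (r * q) * x" using NN[OF q(2) n] by (metis mult.assoc)
      then show ?thesis by (simp add: rq)
    qed
    have qnr: "q * (n * (r * x)) = 0" for x
    proof -
      have "q * (n * (r * x)) = n * (q * r) * x" using NN[OF q(1) n] by (metis mult.assoc)
      then show ?thesis by (simp add: q(7))
    qed
    have "w * n * w = q * (z * (r * n * r) * star z) * q + r * (star z * (q * n * q) * z) * r"
      by (simp add: w_def distrib_left distrib_right mult.assoc rnq qnr)
    also have "\<dots> \<in> N" by (intro Nc q n z(2,3))
    finally show ?thesis .
  qed
  have ww: "w * w \<in> N" using wnw[OF vna_one[OF N(1)]] by simp
  obtain p a where p: "p \<in> bicommutant {w}" "p * p = p" "star p = p" and a: "a \<in> N" "w = (p + p - 1) * a"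
    and n: "\<And>n. n \<in> N \<Longrightarrow> (p + p - 1) * n * (p + p - 1) \<in> N"
    using sign_normalizes[OF N(1,2) w_sa ww wnw] by blast
  have pM: "p \<in> M" using p(1) bicommutant_singleton_subset[OF M wM] by blast
  have "p + p - 1 \<in> vn_normalizer M N" by (rule symmetry_in_vn_normalizer[OF M pM p(2,3) n])
  then have Ts: "T * (p + p - 1) = (p + p - 1) * T" by (rule commutantD[OF T])
  have TN: "T * n = n * T" if "n \<in> N" for n
    using that N NN by (intro commutant_vn_normalizer_commutes[OF M N(1) T]) (auto simp: commutant_def)
  have Tw: "T * w = w * T"
    unfolding a(2) by (metis Ts TN[OF a(1)] mult.assoc)
  have "q * w * r = (q * q) * z * (r * r) + (q * r) * star z * (q * r)"
    by (simp only: w_def distrib_left distrib_right mult.assoc)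
  then have qzr: "q * z * r = q * w * r" by (simp add: q)
  have "T * (q * w * r) = (T * q) * w * r" by (simp only: mult.assoc)
  also have "\<dots> = q * (T * w) * r" by (simp only: TN[OF q(1)] mult.assoc)
  also have "\<dots> = q * w * (T * r)" by (simp only: Tw mult.assoc)
  also have "\<dots> = q * w * r * T" by (simp only: TN[OF q(2)] mult.assoc)
  finally show ?thesis by (simp only: qzr)
qed

text \<open>A partial automorphism of an abelian algebra decomposes into the part where it is the identity and a
  part cut into pieces that are moved off themselves. The moved pieces are corners \<open>(1 - r) z r\<close>. To avoid
  an exhaustion argument, let \<open>Z\<close> be the commutator of \<open>T\<close> and \<open>z\<close>, and \<open>g\<close> the largest projection of
  \<open>N\<close> with \<open>Z g = 0\<close>. For each projection \<open>r\<close> the element \<open>c = z\<^sup>* (1 - r) z r\<close> of \<open>N\<close> satisfies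
  \<open>Z c = 0\<close>, hence vanishes under \<open>f = 1 - g\<close>, and so does the corner. Thus \<open>z f\<close> commutes with all
  projections of \<open>N\<close>: under \<open>f\<close> only the identity part is left. So \<open>z f\<close> lies in \<open>M \<inter> N'\<close>, which gives
  \<open>Z f = 0\<close> and forces \<open>f = 0\<close>.\<close>

lemma normalizing_element_commutes:
  assumes M: "von_neumann_algebra M" and N: "von_neumann_algebra N" "abelian N" "N \<subseteq> M"
    and z: "z \<in> M" "\<And>n. n \<in> N \<Longrightarrow> z * n * star z \<in> N" "\<And>n. n \<in> N \<Longrightarrow> star z * n * z \<in> N"
    and T: "T \<in> commutant (vn_normalizer M N)"
  shows "T * z = z * T"
proof -
  have NN: "x * y = y * x" if "x \<in> N" "y \<in> N" for x y using N(2) that by (simp add: abelian_def)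
  note Nc = vna_closure_rules[OF N(1)] and Mc = vna_closure_rules[OF M]
  have TMN: "T * x = x * T" if "x \<in> M" "x \<in> commutant N" for x
    by (rule commutant_vn_normalizer_commutes[OF M N(1) T that])
  have TN: "T * n = n * T" if "n \<in> N" for n
    using that N NN by (intro TMN) (auto simp: commutant_def)
  define Z where "Z = T * z - z * T"
  \<comment> \<open>multiplying by the commutant makes the common kernel invariant under it, so that \<open>g\<close> lies in \<open>N\<close>\<close>
  let ?S = "{Z * S | S. S \<in> commutant N}"
  obtain g where g: "g * g = g" "star g = g" "\<And>X. (\<forall>s\<in>?S. s * X = 0) \<longleftrightarrow> g * X = X"
    using right_annihilator_projection[of ?S] by blast
  have gX: "g * X = X \<longleftrightarrow> (\<forall>S\<in>commutant N. Z * S * X = 0)" for X using g(3)[of X] by blast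
  have Zg: "Z * S * g = 0" if "S \<in> commutant N" for S using gX g(1) that by blast
  have gN: "g \<in> N"
  proof (rule vna_memI[OF N(1)])
    fix k assume k: "k \<in> commutant N"
    have "s * (k' * g) = 0" if "s \<in> ?S" "k' \<in> commutant N" for s k'
    proof -
      obtain S where S: "s = Z * S" "S \<in> commutant N" using \<open>s \<in> ?S\<close> by blast
      have "Z * (S * k') * g = 0" using commutant_mult[OF S(2) that(2)] by (rule Zg)
      then show ?thesis by (simp add: S mult.assoc)
    qed
    then show "k * g = g * k"
      using k star_commutant[OF vna_star[OF N(1)] k] by (intro annihilator_projection_commutes[OF g]) auto
  qed
  have gc: "g * c = c" if c: "c \<in> N" "Z * c = 0" for c
  proof -
    have "Z * S * c = 0" if "S \<in> commutant N" for S
    proof -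
      have "Z * S * c = Z * c * S" using commutantD[OF that c(1)] by (simp add: mult.assoc)
      then show ?thesis using c(2) by simp
    qed
    then show ?thesis using gX by blast
  qed
  define f where "f = 1 - g"
  have fN: "f \<in> N" unfolding f_def by (intro Nc gN)
  have f: "star f = f" by (simp add: f_def star_diff g)
  have cf: "c * f = 0" if "c \<in> N" "Z * c = 0" for c
    using gc[OF that] NN[OF that(1) fN] by (simp add: f_def left_diff_distrib)
  have a: "star z * z \<in> N" using z(3)[OF vna_one[OF N(1)]] by simp
  have corner: "q * z * r * f = 0"
    if q: "q \<in> N" "r \<in> N" "star q = q" "star r = r" "q * q = q" "r * r = r" "q * r = 0" for q r
  proof -
    define c where "c = star z * q * z * r"
    have cN: "c \<in> N" unfolding c_def by (intro Nc z q)
    have zzN: "z * star z \<in> N" using z(2)[OF vna_one[OF N(1)]] by simp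
    have "z * c = (z * star z * q) * z * r" by (simp only: c_def mult.assoc)
    also have "\<dots> = q * z * (star z * z * r)" unfolding NN[OF zzN q(1)] by (simp only: mult.assoc)
    also have "\<dots> = q * z * r * (star z * z)" unfolding NN[OF a q(2)] by (simp only: mult.assoc)
    finally have zc: "z * c = q * z * r * (star z * z)" .
    have Tqzr: "T * (q * z * r) = q * z * r * T"
      by (rule commutant_vn_normalizer_corner[OF M N z T q])
    have "T * (z * c) = (T * (q * z * r)) * (star z * z)" by (simp only: zc mult.assoc)
    also have "\<dots> = q * z * r * (T * (star z * z))"
      unfolding Tqzr by (simp only: mult.assoc)
    also have "\<dots> = z * c * T" unfolding TN[OF a] zc by (simp only: mult.assoc)
    finally have "Z * c = 0" using TN[OF cN] by (simp add: Z_def left_diff_distrib mult.assoc)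
    then have "c * f = 0" by (rule cf[OF cN])
    have "star (q * z * r * f) * (q * z * r * f) = f * r * star z * (q * q) * z * r * f"
      by (simp add: star_mult f q(3,4) mult.assoc)
    also have "\<dots> = f * r * (c * f)" by (simp only: q(5) c_def mult.assoc)
    finally show ?thesis using \<open>c * f = 0\<close> by (simp add: star_mult_self_eq_0)
  qed
  have "z * f \<in> commutant N"
  proof (rule commute_projections_imp_commutant[OF N(1)])
    fix r assume "r \<in> projections N"
    then have r: "r \<in> N" "r * r = r" "star r = r" by (auto simp: projections_def)
    have q: "1 - r \<in> N" "(1 - r) * (1 - r) = 1 - r" "star (1 - r) = 1 - r" "r * (1 - r) = 0" "(1 - r) * r = 0"
      by (auto intro!: Nc r simp: left_diff_distrib right_diff_distrib r star_diff)
    \<comment> \<open>both corners are needed: together they give \<open>r z f = z r f\<close>\<close>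
    have "(1 - r) * z * r * f = 0" using r q by (intro corner) auto
    then have 1: "z * r * f = r * z * r * f" by (simp add: left_diff_distrib)
    have "r * z * (1 - r) * f = 0" using r q by (intro corner) auto
    then have 2: "r * z * f = r * z * r * f" by (simp add: left_diff_distrib right_diff_distrib)
    have "z * f * r = z * r * f" by (simp only: mult.assoc NN[OF fN r(1)])
    then show "z * f * r = r * (z * f)" by (simp only: 1 2 mult.assoc[symmetric])
  qed
  then have "T * (z * f) = z * f * T" using N(3) fN z(1) by (intro TMN Mc) auto
  also have "\<dots> = z * T * f" by (simp only: mult.assoc TN[OF fN])
  finally have "Z * f = 0" by (simp add: Z_def left_diff_distrib mult.assoc)
  then have "g * f = f" by (rule gc[OF fN])
  then have "f = 0" by (simp add: f_def right_diff_distrib g)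
  then have "g = 1" by (simp add: f_def)
  moreover have "1 \<in> commutant N" by (simp add: commutant_def)
  ultimately have "Z * 1 * 1 = 0" using Zg by blast
  then show ?thesis by (simp add: Z_def)
qed

section \<open>Regularity of the generated von Neumann algebra\<close>

lemma abelian_bicommutant:
  assumes "abelian D" shows "abelian (bicommutant D)"
proof -
  have "D \<subseteq> commutant D" using assms by (auto simp: abelian_def commutant_def)
  then have "bicommutant D \<subseteq> commutant D"
    unfolding bicommutant_def by (rule commutant_antimono)
  then have "\<And>x. x \<in> bicommutant D \<Longrightarrow> x \<in> commutant (bicommutant D)" by auto
  then show ?thesis unfolding abelian_def by (blast intro: commutantD)
qed

text \<open>For \<open>x\<close> normalizing \<open>D\<close>, neither \<open>x\<^sup>* x\<close> nor \<open>x x\<^sup>*\<close> need lie in \<open>D\<close>, but for \<open>z = d x d'\<close> with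
  \<open>d\<close>, \<open>d'\<close> in \<open>D\<close> both \<open>z\<^sup>* z\<close> and \<open>z z\<^sup>*\<close> do, so \<open>T\<close> commutes with \<open>d x d'\<close>. This determines the
  commutator of \<open>T\<close> and \<open>x\<close> except on the common kernel of \<open>D\<close>, which may be nonzero since \<open>D\<close> can act
  degenerately. The projection \<open>p\<close> onto that kernel commutes with \<open>x\<close>, and \<open>x p\<close> annihilates \<open>D\<close> on
  both sides, so it lies in the relative commutant, where \<open>T\<close> commutes as well.\<close>

lemma cstar_normalizer_commutes:
  fixes M :: "'h::chilbert_space bop set"
  assumes M: "von_neumann_algebra M" and D: "star_subalgebra D" "abelian D" "D \<subseteq> M"
    and x: "x \<in> M" "x \<in> cstar_normalizer D"
    and T: "T \<in> commutant (vn_normalizer M (bicommutant D))"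
  shows "T * x = x * T"
proof -
  let ?N = "bicommutant D"
  have Dm: "a * b \<in> D" if "a \<in> D" "b \<in> D" for a b using D(1) that by (simp add: star_subalgebra_def)
  have Ds: "star a \<in> D" if "a \<in> D" for a using D(1) that by (simp add: star_subalgebra_def)
  have xD: "x * d * star x \<in> D" "star x * d * x \<in> D" if "d \<in> D" for d
    using x(2) that by (auto simp: cstar_normalizer_def)
  have N: "von_neumann_algebra ?N" by (rule von_neumann_algebra_bicommutant[OF Ds])
  have abN: "abelian ?N" by (rule abelian_bicommutant[OF D(2)])
  have NM: "?N \<subseteq> M" using bicommutant_mono[OF D(3)] vna_bicommutantD[OF M] by simp
  have DN: "D \<subseteq> ?N" by (rule subset_bicommutant)
  note Mc = vna_closure_rules[OF M]
  have TMN: "T * y = y * T" if "y \<in> M" "y \<in> commutant D" for y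
    using that by (intro commutant_vn_normalizer_commutes[OF M N T]) auto
  have TN: "T * n = n * T" if "n \<in> ?N" for n
  proof (rule TMN)
    show "n \<in> commutant D" using that DN abN by (auto simp: commutant_def abelian_def)
  qed (use NM that in auto)
  have dxd: "T * (d * x * d') = d * x * d' * T" if d: "d \<in> D" "d' \<in> D" for d d'
  proof -
    define z where "z = d * x * d'"
    have zM: "z \<in> M" unfolding z_def using d D(3) x(1) by (intro Mc) auto
    have 1: "z * e * star z \<in> D" if e: "e \<in> D" for e
    proof -
      have "z * e * star z = d * (x * (d' * e * star d') * star x) * star d"
        by (simp add: z_def star_mult mult.assoc)
      also have "\<dots> \<in> D" by (intro Dm Ds xD d e)
      finally show ?thesis .
    qed
    have 2: "star z * e * z \<in> D" if e: "e \<in> D" for e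
    proof -
      have "star z * e * z = star d' * (star x * (star d * e * d) * x) * d'"
        by (simp add: z_def star_mult mult.assoc)
      also have "\<dots> \<in> D" by (intro Dm Ds xD d e)
      finally show ?thesis .
    qed
    have 3: "z * star z \<in> D"
    proof -
      have "z * star z = d * (x * (d' * star d') * star x) * star d"
        by (simp add: z_def star_mult mult.assoc)
      also have "\<dots> \<in> D" by (intro Dm Ds xD d)
      finally show ?thesis .
    qed
    have 4: "star z * z \<in> D"
    proof -
      have "star z * z = star d' * (star x * (star d * d) * x) * d'"
        by (simp add: z_def star_mult mult.assoc)
      also have "\<dots> \<in> D" by (intro Dm Ds xD d)
      finally show ?thesis .
    qed
    have "z * n * star z \<in> ?N" "star z * n * z \<in> ?N" if "n \<in> ?N" for n
      using conjugate_mem_bicommutant[OF D(2) 1 4 3 that]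
        conjugate_mem_bicommutant[of D "star z" n, OF D(2)] 1 2 3 4 that by (auto simp: star_star)
    then show ?thesis using normalizing_element_commutes[OF M N abN NM zM _ _ T] unfolding z_def by blast
  qed
  define Z where "Z = T * x - x * T"
  have dZd: "d * (Z * d') = 0" if d: "d \<in> D" "d' \<in> D" for d d'
  proof -
    have dN: "d \<in> ?N" "d' \<in> ?N" using d DN by auto
    have "d * (Z * d') = (d * T) * x * d' - d * x * (T * d')"
      by (simp only: Z_def left_diff_distrib right_diff_distrib mult.assoc)
    also have "\<dots> = T * (d * x * d') - d * x * d' * T"
      unfolding TN[OF dN(1), symmetric] TN[OF dN(2)] by (simp only: mult.assoc)
    finally show ?thesis using dxd[OF d] by simp
  qed
  obtain p where p: "p * p = p" "star p = p" "\<And>X. (\<forall>s\<in>D. s * X = 0) \<longleftrightarrow> p * X = X"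
    using right_annihilator_projection[of D] by blast
  have Dp: "d * p = 0" if "d \<in> D" for d using p(1,3) that by blast
  have pD: "p * d = 0" if "d \<in> D" for d
  proof -
    have "star (star d * p) = 0" using Dp[OF Ds[OF that]] by simp
    then show ?thesis by (simp add: star_mult star_star p(2))
  qed
  have pN: "p \<in> ?N" unfolding bicommutant_def
  proof (rule commutantI)
    fix k assume k: "k \<in> commutant D"
    have "s * (k' * p) = 0" if "s \<in> D" "k' \<in> commutant D" for s k'
      using commutantD[OF that(2,1)] Dp[OF that(1)] by (metis mult.assoc mult_zero_right)
    then have "k * p = p * k"
      using k star_commutant[OF Ds k] by (intro annihilator_projection_commutes[OF p]) auto
    then show "p * k = k * p" by simp
  qed
  have kill: "s * (y * p) = 0" if s: "s \<in> D" and y: "\<And>d. d \<in> D \<Longrightarrow> star y * d * y \<in> D" for s y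
  proof -
    have "star (s * (y * p)) * (s * (y * p)) = p * ((star y * (star s * s) * y) * p)"
      by (simp add: star_mult p(2) mult.assoc)
    also have "\<dots> = 0" using Dp[OF y[OF Dm[OF Ds[OF s] s]]] by simp
    finally show ?thesis by (simp only: star_mult_self_eq_0)
  qed
  have xp: "x * p = p * x"
    using kill[of _ x] kill[of _ "star x"] xD
    by (intro annihilator_projection_commutes[OF p]) (auto simp: star_star)
  have pT: "T * p = p * T" by (rule TN[OF pN])
  have pZ: "p * Z = Z * p"
  proof -
    have "p * Z = (p * T) * x - (p * x) * T" by (simp only: Z_def right_diff_distrib mult.assoc)
    also have "\<dots> = (T * p) * x - (x * p) * T" by (simp only: pT xp)
    also have "\<dots> = T * (p * x) - x * (p * T)" by (simp only: mult.assoc)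
    also have "\<dots> = T * (x * p) - x * (T * p)" by (simp only: pT xp)
    also have "\<dots> = Z * p" by (simp only: Z_def left_diff_distrib mult.assoc)
    finally show ?thesis .
  qed
  have Zd: "Z * d = 0" if "d \<in> D" for d
  proof -
    have "p * (Z * d) = Z * d" using dZd[OF _ that] p(3) by blast
    moreover have "p * (Z * d) = Z * (p * d)" by (simp only: mult.assoc[symmetric] pZ)
    ultimately show ?thesis using pD[OF that] by simp
  qed
  have "d * star Z = 0" if "d \<in> D" for d
  proof -
    have "star (Z * star d) = 0" using Zd[OF Ds[OF that]] by simp
    then show ?thesis by (simp add: star_mult star_star)
  qed
  then have "p * star Z = star Z" using p(3) by blast
  then have "star (p * star Z) = star (star Z)" by simp
  then have Zp: "Z * p = Z" by (simp add: star_mult star_star p(2))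
  have "x * p \<in> commutant D"
  proof (rule commutantI)
    fix d assume d: "d \<in> D"
    have "x * p * d = x * (p * d)" by (simp only: mult.assoc)
    moreover have "d * (x * p) = d * p * x" unfolding xp by (simp only: mult.assoc)
    ultimately show "x * p * d = d * (x * p)" using Dp[OF d] pD[OF d] by simp
  qed
  then have "T * (x * p) = x * p * T" using NM pN x(1) by (intro TMN Mc) auto
  also have "\<dots> = x * T * p" by (simp only: mult.assoc pT)
  finally have "Z * p = 0" by (simp add: Z_def left_diff_distrib mult.assoc)
  with Zp show ?thesis by (simp add: Z_def)
qed

lemma vn_normalizer_star:
  assumes M: "von_neumann_algebra M" and u: "u \<in> vn_normalizer M N"
  shows "star u \<in> vn_normalizer M N"
proof -
  have u: "u \<in> M" "star u * u = 1" "u * star u = 1" "(\<lambda>x. u * x * star u) ` N = N"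
    using u by (auto simp: vn_normalizer_def unitaries_def)
  have inv: "star u * (u * x * star u) * u = x" for x
    using u(2) by (metis mult.assoc mult_1 mult_1_right)
  have "(\<lambda>x. star u * x * u) ` ((\<lambda>x. u * x * star u) ` N) = N"
    unfolding image_image by (simp add: inv)
  then have "(\<lambda>x. star u * x * star (star u)) ` N = N" by (simp add: u(4) star_star)
  then show ?thesis using u vna_star[OF M] by (simp add: vn_normalizer_def unitaries_def star_star)
qed

lemma star_hom_image:
  assumes "star_hom \<pi>" "star_subalgebra C"
  shows "star_subalgebra (\<pi> ` C)"
proof -
  have h: "\<pi> x + \<pi> y = \<pi> (x + y)" "c *\<^sub>C \<pi> x = \<pi> (c *\<^sub>C x)" "\<pi> x * \<pi> y = \<pi> (x * y)" "star (\<pi> x) = \<pi> (star x)"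
    for x y c using assms(1) by (simp_all add: star_hom_def)
  have C: "complex_vector.subspace C" "\<And>x y. x \<in> C \<Longrightarrow> y \<in> C \<Longrightarrow> x * y \<in> C" "\<And>x. x \<in> C \<Longrightarrow> star x \<in> C"
    using assms(2) by (auto simp: star_subalgebra_def)
  have "complex_vector.subspace (\<pi> ` C)"
  proof (rule complex_vector.subspaceI)
    have "\<pi> 0 = 0" using h(2)[of 0 0] by simp
    then show "0 \<in> \<pi> ` C" using complex_vector.subspace_0[OF C(1)] by (metis imageI)
  qed (use C(1) in \<open>auto simp: h intro!: imageI intro: complex_vector.subspace_add complex_vector.subspace_scale\<close>)
  then show ?thesis using C(2,3) by (auto simp: star_subalgebra_def h)
qed

text \<open>If \<open>T\<close> commutes with the unitary normalizer, so does \<open>T\<^sup>*\<close>, and the elements of \<open>A\<close> whose image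
  commutes with both form a closed *-subalgebra containing the C*-normalizer of \<open>C\<close>; regularity makes it
  everything. Passing to commutants gives the nontrivial inclusion.\<close>

lemma vn_regular_bicommutant_image:
  fixes C :: "'a::cstar_algebra set"
    and \<pi> :: "'a \<Rightarrow> 'h::chilbert_space bop"
  assumes C: "star_subalgebra C" "abelian C" "cstar_regular C" and \<pi>: "star_hom \<pi>"
  shows "vn_regular (bicommutant (range \<pi>)) (bicommutant (\<pi> ` C))"
proof -
  let ?M = "bicommutant (range \<pi>)" and ?N = "bicommutant (\<pi> ` C)"
  let ?G = "vn_normalizer ?M ?N"
  have h: "\<pi> (x + y) = \<pi> x + \<pi> y" "\<pi> (c *\<^sub>C x) = c *\<^sub>C \<pi> x" "\<pi> (x * y) = \<pi> x * \<pi> y" "\<pi> (star x) = star (\<pi> x)"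
    for x y c using \<pi> by (simp_all add: star_hom_def)
  have "star s \<in> range \<pi>" if "s \<in> range \<pi>" for s using that by (auto simp: h(4)[symmetric])
  then have M: "von_neumann_algebra ?M" by (rule von_neumann_algebra_bicommutant)
  have D: "star_subalgebra (\<pi> ` C)" by (rule star_hom_image[OF \<pi> C(1)])
  have abD: "abelian (\<pi> ` C)" using C(2) by (auto simp: abelian_def h(3)[symmetric])
  have DM: "\<pi> ` C \<subseteq> ?M" using subset_bicommutant[of "range \<pi>"] by blast
  have "commutant ?G \<subseteq> commutant (range \<pi>)"
  proof
    fix T assume T: "T \<in> commutant ?G"
    have Ts: "star T \<in> commutant ?G" by (rule star_commutant[OF vn_normalizer_star[OF M] T])
    define B where "B = \<pi> -` (commutant {T} \<inter> commutant {star T})"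
    have "bounded_linear \<pi>"
      by (rule bounded_linear_intro[of _ 1]) (simp_all add: h scaleR_scaleC star_hom_contractive[OF \<pi>])
    then have "continuous_on UNIV \<pi>" by (rule linear_continuous_on)
    then have "closed B" unfolding B_def
      by (intro continuous_closed_vimage closed_Int closed_commutant)
        (simp add: continuous_on_eq_continuous_at)
    moreover have "star_subalgebra B"
    proof -
      have "star_subalgebra (commutant {T, star T})"
        by (rule star_subalgebra_commutant) (auto simp: star_star)
      moreover have "commutant {T, star T} = commutant {T} \<inter> commutant {star T}" by (auto simp: commutant_def)
      ultimately have E: "star_subalgebra (commutant {T} \<inter> commutant {star T})" (is "star_subalgebra ?E") by simp
      then have E': "complex_vector.subspace ?E" by (simp add: star_subalgebra_def)
      have "\<pi> 0 = 0" using h(2)[of 0 0] by simp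
      then have "complex_vector.subspace B"
        using complex_vector.subspace_0[OF E'] complex_vector.subspace_add[OF E'] complex_vector.subspace_scale[OF E']
        by (intro complex_vector.subspaceI) (simp_all only: B_def vimage_eq h)
      then show ?thesis using E by (simp add: star_subalgebra_def B_def h)
    qed
    moreover have "cstar_normalizer C \<subseteq> B"
    proof
      fix n assume n: "n \<in> cstar_normalizer C"
      have "\<pi> n \<in> cstar_normalizer (\<pi> ` C)"
        using n by (auto simp: cstar_normalizer_def h[symmetric])
      moreover have "\<pi> n \<in> ?M" using subset_bicommutant[of "range \<pi>"] by blast
      ultimately have "T * \<pi> n = \<pi> n * T" "star T * \<pi> n = \<pi> n * star T"
        using cstar_normalizer_commutes[OF M D abD DM] T Ts by blast+
      then show "n \<in> B" by (simp add: B_def commutant_def)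
    qed
    ultimately have "cstar_generated (cstar_normalizer C) \<subseteq> B" by (auto simp: cstar_generated_def)
    then have "B = UNIV" using C(3) by (simp add: cstar_regular_def top.extremum_unique)
    then have "\<pi> y * T = T * \<pi> y" for y by (auto simp: B_def commutant_def)
    then show "T \<in> commutant (range \<pi>)" by (auto simp: commutant_def)
  qed
  then have "?M \<subseteq> bicommutant ?G" unfolding bicommutant_def by (rule commutant_antimono)
  moreover have "bicommutant ?G \<subseteq> ?M"
    using bicommutant_mono[of ?G ?M] by (auto simp: vn_normalizer_def unitaries_def)
  ultimately show ?thesis by (auto simp: vn_regular_def)
qed

section \<open>Infinite families of equivalent projections\<close>

text \<open>By Pythagoras the Cauchy criterion for \<open>f\<close> is the one for the squared norms.\<close>

lemma summable_orthogonal: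
  fixes f :: "nat \<Rightarrow> 'a::{real_inner,banach}"
  assumes orth: "\<And>i j. i \<noteq> j \<Longrightarrow> inner (f i) (f j) = 0"
    and bound: "\<And>n. (\<Sum>i<n. (norm (f i))\<^sup>2) \<le> K"
  shows "summable f"
  unfolding summable_Cauchy
proof (intro allI impI)
  fix e :: real assume e: "0 < e"
  have "summable (\<lambda>i. (norm (f i))\<^sup>2)" by (rule summableI_nonneg_bounded[OF _ bound]) simp
  then obtain n0 where n0: "\<And>m n. m \<ge> n0 \<Longrightarrow> norm (\<Sum>i=m..<n. (norm (f i))\<^sup>2) < e\<^sup>2"
    using e unfolding summable_Cauchy by (metis zero_less_power)
  have "norm (sum f {m..<n}) < e" if "m \<ge> n0" for m n
  proof -
    have "(norm (sum f {m..<n}))\<^sup>2 = (\<Sum>i=m..<n. (norm (f i))\<^sup>2)"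
      by (rule norm_sum_Pythagorean) (simp_all add: pairwise_def orthogonal_def orth)
    also have "\<dots> < e\<^sup>2" using n0[OF that, of n] by (simp add: abs_less_iff)
    finally show ?thesis by (rule power_less_imp_less_base) (use e in simp)
  qed
  then show "\<exists>N. \<forall>m\<ge>N. \<forall>n. norm (sum f {m..<n}) < e" by blast
qed

lemma Bessel_projections:
  fixes p :: "nat \<Rightarrow> 'h::chilbert_space bop"
  assumes p: "\<And>i. p i * p i = p i" "\<And>i. star (p i) = p i" and orth: "\<And>i j. i \<noteq> j \<Longrightarrow> p i * p j = 0"
  shows "(\<Sum>i<n. (norm (bop_apply (p i) h))\<^sup>2) \<le> (norm h)\<^sup>2"
proof -
  define y where "y = (\<Sum>i<n. bop_apply (p i) h)"
  define s where "s = (\<Sum>i<n. (norm (bop_apply (p i) h))\<^sup>2)"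
  have ip: "inner (bop_apply (p i) h) (bop_apply (p j) h) = inner h (bop_apply (p i * p j) h)" for i j
    using inner_star_left[of "p i" h "bop_apply (p j) h"] by (simp add: p bop_apply_simps)
  have "(norm y)\<^sup>2 = s" unfolding y_def s_def
    by (rule norm_sum_Pythagorean) (simp_all add: pairwise_def orthogonal_def ip orth bop_apply_simps(1))
  moreover have "inner h y = s"
    unfolding y_def s_def inner_sum_right by (simp add: power2_norm_eq_inner ip p)
  moreover have "(norm (h - y))\<^sup>2 = (norm h)\<^sup>2 - 2 * inner h y + (norm y)\<^sup>2"
    by (simp add: power2_norm_eq_inner inner_diff_left inner_diff_right inner_commute)
  ultimately show ?thesis using zero_le_power2[of "norm (h - y)"] unfolding s_def by linarith
qed

lemma strong_limit_exists:
  fixes X :: "nat \<Rightarrow> 'h::chilbert_space bop"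
  assumes conv: "\<And>h. convergent (\<lambda>n. bop_apply (X n) h)" and bound: "\<And>n. norm (X n) \<le> K"
  shows "\<exists>Y. \<forall>h. (\<lambda>n. bop_apply (X n) h) \<longlonglongrightarrow> bop_apply Y h"
proof -
  obtain F where F: "\<And>h. (\<lambda>n. bop_apply (X n) h) \<longlonglongrightarrow> F h"
    using conv unfolding convergent_def by metis
  have add: "F (x + y) = F x + F y" for x y
    using tendsto_add[OF F[of x] F[of y]] F[of "x + y"] LIMSEQ_unique
    by (auto simp: blinfun.bilinear_simps)
  have sc: "F (c *\<^sub>C x) = c *\<^sub>C F x" for c x
    using bounded_linear.tendsto[OF bounded_linear_scaleC F[of x], of c] F[of "c *\<^sub>C x"] LIMSEQ_unique
    by (auto simp: bop_apply_scaleC)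
  have nF: "norm (F x) \<le> norm x * K" for x
  proof (rule Lim_norm_ubound[OF _ F])
    have "norm (bop_apply (X n) x) \<le> norm x * K" for n
      using norm_bop_apply_le[of "X n" x] mult_right_mono[OF bound[of n] norm_ge_zero[of x]]
      by (simp add: mult.commute)
    then show "\<forall>\<^sub>F n in sequentially. norm (bop_apply (X n) x) \<le> norm x * K" by simp
  qed simp
  have "bounded_linear F"
    by (rule bounded_linear_intro[of _ K]) (simp_all add: add scaleR_scaleC sc nF)
  then have *: "blinfun_apply (Blinfun F) = F" by (rule bounded_linear_Blinfun_apply)
  have "bop_apply (Abs_bop (Blinfun F)) = F"
    by (subst Abs_bop_inverse) (simp_all add: * sc)
  then show ?thesis using F by (intro exI[of _ "Abs_bop (Blinfun F)"]) simp
qed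

lemma strong_limit_in_vna:
  assumes M: "von_neumann_algebra M" and X: "\<And>n. X n \<in> M"
    and Y: "\<And>h. (\<lambda>n. bop_apply (X n) h) \<longlonglongrightarrow> bop_apply Y h"
  shows "Y \<in> M"
proof (rule vna_memI[OF M], rule bop_eqI)
  fix S h assume S: "S \<in> commutant M"
  have "bop_apply (X n) (bop_apply S h) = bop_apply S (bop_apply (X n) h)" for n
    using commutantD[OF S X] by (metis bop_apply_simps(5))
  then have "(\<lambda>n. bop_apply S (bop_apply (X n) h)) \<longlonglongrightarrow> bop_apply Y (bop_apply S h)"
    using Y[of "bop_apply S h"] by simp
  moreover have "(\<lambda>n. bop_apply S (bop_apply (X n) h)) \<longlonglongrightarrow> bop_apply S (bop_apply Y h)"
    by (rule blinfun.tendsto[OF tendsto_const Y])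
  ultimately show "bop_apply (S * Y) h = bop_apply (Y * S) h"
    by (simp add: bop_apply_simps LIMSEQ_unique)
qed

text \<open>The range projection of an isometry is equivalent to \<open>1\<close>.\<close>

lemma finite_vna_isometry:
  assumes M: "finite_vna M" and Y: "Y \<in> M" "star Y * Y = 1"
  shows "Y * star Y = 1"
proof -
  have vM: "von_neumann_algebra M" and f: "finite_projection M 1" using M by (auto simp: finite_vna_def)
  have "Y * star Y * (Y * star Y) = Y * (star Y * Y) * star Y" by (simp only: mult.assoc)
  then have "Y * star Y \<in> projections M"
    using Y by (auto simp: projections_def star_mult star_star intro!: vna_closure_rules[OF vM])
  moreover have "murray_von_neumann_equiv M (Y * star Y) 1"
    unfolding murray_von_neumann_equiv_def using Y vna_star[OF vM]
    by (intro bexI[of _ "star Y"]) (auto simp: star_star)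
  ultimately show ?thesis using f by (auto simp: finite_projection_def subprojection_def)
qed

text \<open>An infinite sequence of orthogonal conjugates \<open>P i\<close> of a nonzero projection yields a shift: the
  partial isometries \<open>v i\<close> carry \<open>P i\<close> to \<open>P (i + 1)\<close>, and their sum together with the complement of all
  \<open>P i\<close> is a proper isometry. The partial sums \<open>W n\<close> move \<open>P i\<close> to \<open>P (i + 1)\<close> for \<open>i < n\<close>, kill \<open>P n\<close>
  and fix all later ones, so that \<open>W n\<close> is an isometry up to \<open>P n\<close>, which tends to \<open>0\<close> strongly.\<close>

lemma finite_vna_no_infinite_orbit:
  fixes M :: "'h::chilbert_space bop set"
  assumes M: "finite_vna M" and p: "p \<in> projections M" and u: "\<And>i::nat. u i \<in> unitaries M"
    and orth: "\<And>i j. i \<noteq> j \<Longrightarrow> (u i * p * star (u i)) * (u j * p * star (u j)) = 0"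
  shows "p = 0"
proof -
  have vM: "von_neumann_algebra M" using M by (auto simp: finite_vna_def)
  note Mc = vna_closure_rules[OF vM]
  have pp: "p \<in> M" "p * p = p" "star p = p" using p by (auto simp: projections_def)
  have uu: "u i \<in> M" "star (u i) * u i = 1" "u i * star (u i) = 1" for i
    using u by (auto simp: unitaries_def)
  have u1: "star (u i) * (u i * x) = x" for i x by (simp add: mult.assoc[symmetric] uu)
  have p1: "p * (p * x) = p * x" for x by (simp add: mult.assoc[symmetric] pp)
  define P where "P i = u i * p * star (u i)" for i
  define v where "v i = u (Suc i) * p * star (u i)" for i
  have P: "P i * P i = P i" "star (P i) = P i" "P i \<in> M" for i
    by (auto simp: P_def mult.assoc star_mult star_star u1 p1 pp intro!: Mc uu)
  have PP: "P i * P j = 0" if "i \<noteq> j" for i j using orth[OF that] by (simp add: P_def)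
  have v: "star (v i) * v i = P i" "P (Suc i) * v i = v i" "v i \<in> M" for i
    by (auto simp: P_def v_def mult.assoc star_mult star_star u1 p1 pp intro!: Mc uu)
  have Pv: "P j * v i = 0" if "j \<noteq> Suc i" for i j
  proof -
    have "P j * v i = (P j * P (Suc i)) * v i" by (simp only: v(2) mult.assoc)
    then show ?thesis using PP[OF that] by simp
  qed
  have norm_sq: "(norm (bop_apply x h))\<^sup>2 = inner (bop_apply (star x * x) h) h" for x :: "'h bop" and h
    using inner_star_left[of x "bop_apply x h" h] by (simp add: power2_norm_eq_inner bop_apply_simps)
  define W where "W n = 1 - P 0 + (\<Sum>i<n. v i - P (Suc i))" for n
  have W0: "W 0 = 1 - P 0" and WS: "W (Suc n) = W n + (v n - P (Suc n))" for n
    by (simp_all add: W_def)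
  have WM: "W n \<in> M" for n
    by (induction n) (auto simp: W0 WS intro!: Mc P v)
  have PW: "P j * W n = P j" if "j > n" for j n
    using that
  proof (induction n)
    case 0
    then show ?case by (simp add: W0 right_diff_distrib PP)
  next
    case (Suc n)
    then show ?case by (simp add: WS distrib_left right_diff_distrib Pv PP)
  qed
  have P0W: "P 0 * W n = 0" for n
    by (induction n) (simp_all add: W0 WS distrib_left right_diff_distrib P Pv PP)
  have WW: "star (W n) * W n = 1 - P n" for n
  proof (induction n)
    case 0
    show ?case by (simp add: W0 star_diff P left_diff_distrib right_diff_distrib)
  next
    case (Suc n)
    let ?w = "W n" and ?v = "v n" and ?p = "P (Suc n)"
    have vp: "star ?v * ?p = star ?v"
      using arg_cong[OF v(2)[of n], of star] by (simp add: star_mult P)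
    have pw: "?p * ?w = ?p" by (rule PW) simp
    have "star ?v * ?w = (star ?v * ?p) * ?w" by (simp add: vp)
    also have "\<dots> = star ?v * (?p * ?w)" by (simp only: mult.assoc)
    finally have vw: "star ?v * ?w = star ?v" by (simp add: pw vp)
    have wv: "star ?w * ?v = ?v"
      using arg_cong[OF vw, of star] by (simp add: star_mult star_star)
    have wp: "star ?w * ?p = ?p"
      using arg_cong[OF pw, of star] by (simp add: star_mult P)
    show ?case
      by (simp add: WS star_add star_diff P v vp vw wv wp pw Suc
          distrib_left distrib_right left_diff_distrib right_diff_distrib)
  qed
  have Wnorm: "(norm (bop_apply (W n) h))\<^sup>2 = (norm h)\<^sup>2 - (norm (bop_apply (P n) h))\<^sup>2" for n h
  proof -
    have "(norm (bop_apply (P n) h))\<^sup>2 = inner (bop_apply (P n) h) h" using norm_sq[of "P n"] by (simp add: P)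
    then show ?thesis
      using norm_sq[of "W n" h] by (simp add: WW bop_apply_simps inner_diff_left power2_norm_eq_inner)
  qed
  have "norm (W n) \<le> 1" for n
  proof (rule norm_bop_leI)
    fix h
    show "norm (bop_apply (W n) h) \<le> 1 * norm h" unfolding mult_1
      by (rule power2_le_imp_le) (simp_all add: Wnorm)
  qed simp
  moreover have "convergent (\<lambda>n. bop_apply (W n) h)" for h
  proof -
    have ip: "inner (bop_apply (P i) x) (bop_apply (P j) y) = 0" if "i \<noteq> j" for i j x y
      using inner_star_left[of "P i" x "bop_apply (P j) y"] bop_apply_simps(5)[of "P i" "P j" y] PP[OF that]
      by (simp add: P bop_apply_simps(1))
    have vP: "bop_apply (v i) h = bop_apply (P (Suc i)) (bop_apply (v i) h)" for i
      by (simp only: bop_apply_simps(5)[symmetric] v)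
    have bes: "(\<Sum>i<n. (norm (bop_apply (P i) h))\<^sup>2) \<le> (norm h)\<^sup>2" for n
      by (rule Bessel_projections[OF P(1,2) PP])
    have nv: "(norm (bop_apply (v i) h))\<^sup>2 = (norm (bop_apply (P i) h))\<^sup>2" for i
      using norm_sq[of "v i" h] norm_sq[of "P i" h] by (simp add: v P)
    have sv: "summable (\<lambda>i. bop_apply (v i) h)"
    proof (rule summable_orthogonal)
      show "inner (bop_apply (v i) h) (bop_apply (v j) h) = 0" if "i \<noteq> j" for i j
        by (subst (1 2) vP) (use that in \<open>simp add: ip\<close>)
      show "(\<Sum>i<n. (norm (bop_apply (v i) h))\<^sup>2) \<le> (norm h)\<^sup>2" for n
        unfolding nv by (rule bes)
    qed
    have "summable (\<lambda>i. bop_apply (P i) h)" by (rule summable_orthogonal[OF ip bes])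
    then have "summable (\<lambda>i. bop_apply (P (Suc i)) h)"
      using summable_Suc_iff[of "\<lambda>i. bop_apply (P i) h"] by simp
    with sv have "summable (\<lambda>i. bop_apply (v i) h - bop_apply (P (Suc i)) h)" by (rule summable_diff)
    then have "convergent (\<lambda>n. \<Sum>i<n. bop_apply (v i) h - bop_apply (P (Suc i)) h)"
      by (simp add: summable_iff_convergent)
    then have "convergent (\<lambda>n. bop_apply (1 - P 0) h + (\<Sum>i<n. bop_apply (v i) h - bop_apply (P (Suc i)) h))"
      by (intro convergent_add convergent_const)
    moreover have "bop_apply (W n) h = bop_apply (1 - P 0) h + (\<Sum>i<n. bop_apply (v i) h - bop_apply (P (Suc i)) h)" for n
      by (induction n) (simp_all add: W0 WS bop_apply_simps)
    ultimately show ?thesis by simp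
  qed
  ultimately obtain Y where Y: "\<And>h. (\<lambda>n. bop_apply (W n) h) \<longlonglongrightarrow> bop_apply Y h"
    using strong_limit_exists[of W 1] by blast
  have YM: "Y \<in> M" by (rule strong_limit_in_vna[OF vM WM Y])
  have Plim: "(\<lambda>n. bop_apply (P n) h) \<longlonglongrightarrow> 0" for h
  proof -
    have "summable (\<lambda>n. (norm (bop_apply (P n) h))\<^sup>2)"
      by (rule summableI_nonneg_bounded[OF _ Bessel_projections[OF P(1,2) PP]]) simp
    then have "(\<lambda>n. (norm (bop_apply (P n) h))\<^sup>2) \<longlonglongrightarrow> 0" by (rule summable_LIMSEQ_zero)
    then have "(\<lambda>n. sqrt ((norm (bop_apply (P n) h))\<^sup>2)) \<longlonglongrightarrow> sqrt 0" by (rule tendsto_real_sqrt)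
    then show ?thesis by (simp add: tendsto_norm_zero_iff)
  qed
  have "star Y * Y = 1"
  proof (rule bop_eqI)
    fix h
    have "inner (bop_apply (star Y * Y) h) k = inner (bop_apply 1 h) k" for k
    proof -
      have "inner (bop_apply (W n) h) (bop_apply (W n) k) = inner (h - bop_apply (P n) h) k" for n
        using inner_star_left[of "W n" "bop_apply (W n) h" k] bop_apply_simps(5)[of "star (W n)" "W n" h]
        by (simp add: WW bop_apply_simps)
      moreover have "(\<lambda>n. inner (bop_apply (W n) h) (bop_apply (W n) k)) \<longlonglongrightarrow> inner (bop_apply Y h) (bop_apply Y k)"
        by (intro tendsto_inner Y)
      moreover have "(\<lambda>n. inner (h - bop_apply (P n) h) k) \<longlonglongrightarrow> inner (h - 0) k"
        by (intro tendsto_inner tendsto_diff tendsto_const Plim)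
      ultimately have "inner (bop_apply Y h) (bop_apply Y k) = inner h k"
        using LIMSEQ_unique by fastforce
      then show ?thesis
        using inner_star_left[of Y "bop_apply Y h" k] by (simp add: bop_apply_simps)
    qed
    then show "bop_apply (star Y * Y) h = bop_apply 1 h" by (metis vector_eq_rdot)
  qed
  then have YY: "Y * star Y = 1" by (rule finite_vna_isometry[OF M YM])
  \<comment> \<open>the shift misses \<open>P 0\<close>, so the isometry is proper\<close>
  have "P 0 * Y = 0"
  proof (rule bop_eqI)
    fix h
    have "(\<lambda>n. bop_apply (P 0) (bop_apply (W n) h)) \<longlonglongrightarrow> bop_apply (P 0) (bop_apply Y h)"
      by (rule blinfun.tendsto[OF tendsto_const Y])
    moreover have "bop_apply (P 0) (bop_apply (W n) h) = 0" for n
      by (simp only: bop_apply_simps(5)[symmetric] P0W bop_apply_simps(1))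
    ultimately show "bop_apply (P 0 * Y) h = bop_apply 0 h"
      by (simp add: bop_apply_simps LIMSEQ_const_iff)
  qed
  then have "P 0 * (Y * star Y) = 0" by (simp add: mult.assoc[symmetric])
  then have "P 0 = 0" by (simp add: YY)
  then have "star (u 0) * P 0 * u 0 = 0" by simp
  moreover have "star (u 0) * P 0 * u 0 = p" by (simp add: P_def mult.assoc u1 uu)
  ultimately show ?thesis by simp
qed

section \<open>Minimal projections of a regular subalgebra\<close>

text \<open>A projection \<open>r\<close> of \<open>N\<close> satisfies \<open>r p = 0\<close> or \<open>r p = p\<close> by minimality; elements \<open>c\<close> with \<open>c p\<close> a
  multiple of \<open>p\<close> form a closed subspace, and projections are total.\<close>

lemma minimal_projection_scalar:
  fixes N :: "'h::chilbert_space bop set"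
  assumes N: "von_neumann_algebra N" "abelian N" and p: "minimal_projection N p" and c: "c \<in> N"
  shows "\<exists>l. c * p = l *\<^sub>C p"
proof -
  have NN: "x * y = y * x" if "x \<in> N" "y \<in> N" for x y using N(2) that by (simp add: abelian_def)
  have pp: "p \<in> N" "p * p = p" "star p = p" "p \<noteq> 0"
    and min: "\<And>q. q \<in> projections N \<Longrightarrow> p * q = q \<Longrightarrow> q = 0 \<or> q = p"
    using p by (auto simp: minimal_projection_def projections_def subprojection_def)
  obtain k where "bop_apply p k \<noteq> 0" using pp(4) bop_eqI[of p 0] by (auto simp: bop_apply_simps)
  define h where "h = (1 / norm (bop_apply p k)) *\<^sub>R bop_apply p k"
  have h: "norm h = 1" using \<open>bop_apply p k \<noteq> 0\<close> by (simp add: h_def)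
  have "bop_apply p (bop_apply p k) = bop_apply p k" using bop_apply_simps(5)[of p p k] pp(2) by simp
  then have ph: "bop_apply p h = h" by (simp add: h_def blinfun.bilinear_simps)
  define V where "V = {c. \<exists>l. c * p = l *\<^sub>C p}"
  \<comment> \<open>the multiple is read off at the unit vector \<open>h\<close>; only continuity in \<open>c\<close> matters\<close>
  define ev where "ev c = inner (bop_apply c h) h *\<^sub>R p + inner (bop_apply c h) (\<i> *\<^sub>C h) *\<^sub>R (\<i> *\<^sub>C p)" for c
  have "c * p = ev c" if "c * p = l *\<^sub>C p" for c l
  proof -
    have "bop_apply c h = l *\<^sub>C h"
      using arg_cong[OF that, of "\<lambda>T. bop_apply T h"] by (simp add: bop_apply_simps ph)
    moreover have hh: "cinner h h = 1"
    proof (rule complex_eqI)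
      show "Re (cinner h h) = Re 1" using h by (simp add: inner_eq_Re_cinner[symmetric] power2_norm_eq_inner[symmetric])
      show "Im (cinner h h) = Im 1" using cinner_commute[of h h] by (simp add: complex_eq_iff)
    qed
    ultimately have "inner (bop_apply c h) h = Re l" "inner (bop_apply c h) (\<i> *\<^sub>C h) = Im l"
      by (simp_all add: inner_eq_Re_cinner cinner_scaleC_left cinner_scaleC_right)
    moreover have "l *\<^sub>C p = Re l *\<^sub>R p + Im l *\<^sub>R (\<i> *\<^sub>C p)"
      by (simp add: scaleR_scaleC scaleC_scaleC scaleC_add_left[symmetric])
        (metis complex_eq mult.commute)
    ultimately show ?thesis using that by (simp add: ev_def)
  qed
  moreover have "ev c = (cinner (bop_apply c h) h) *\<^sub>C p" for c
  proof -
    have "Im (cinner (bop_apply c h) h) = inner (bop_apply c h) (\<i> *\<^sub>C h)" by (rule Im_cinner)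
    then show ?thesis unfolding ev_def inner_eq_Re_cinner[of _ h]
      by (simp add: scaleR_scaleC scaleC_scaleC scaleC_add_left[symmetric])
        (metis complex_eq mult.commute)
  qed
  ultimately have V_eq: "V = {c. c * p = ev c}" unfolding V_def by metis
  have "bounded_linear (\<lambda>c. bop_apply c h)"
    by (rule bounded_linear_intro[of _ "norm h"]) (simp_all add: bop_apply_simps bop_apply_scaleR norm_bop_apply_le)
  then have cont: "continuous_on UNIV (\<lambda>c. bop_apply c h)" by (rule linear_continuous_on)
  have "closed V" unfolding V_eq ev_def
    by (intro closed_Collect_eq continuous_on_add continuous_on_scaleR continuous_on_inner
        continuous_on_mult continuous_on_const continuous_on_id cont)
  moreover have "complex_vector.subspace V"
  proof (rule complex_vector.subspaceI)
    show "0 \<in> V" unfolding V_def by (auto intro: exI[of _ 0])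
    show "x + y \<in> V" if "x \<in> V" "y \<in> V" for x y
      using that unfolding V_def by (auto simp: distrib_right scaleC_add_left[symmetric])
    show "l *\<^sub>C x \<in> V" if "x \<in> V" for l x
      using that unfolding V_def by (auto simp: mult_scaleC_left scaleC_scaleC)
  qed
  moreover have "projections N \<subseteq> V"
  proof
    fix r assume "r \<in> projections N"
    then have r: "r \<in> N" "r * r = r" "star r = r" by (auto simp: projections_def)
    have rp: "r * p = p * r" by (rule NN[OF r(1) pp(1)])
    have "r * p * (r * p) = r * (p * r) * p" by (simp only: mult.assoc)
    also have "\<dots> = (r * r) * (p * p)" by (simp only: rp[symmetric] mult.assoc)
    finally have "r * p \<in> projections N"
      using vna_mult[OF N(1) r(1) pp(1)] r pp by (simp add: projections_def star_mult rp)
    moreover have "p * (r * p) = r * p"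
    proof -
      have "p * (r * p) = (p * r) * p" by (simp only: mult.assoc)
      also have "\<dots> = r * (p * p)" by (simp only: rp[symmetric] mult.assoc)
      finally show ?thesis by (simp add: pp)
    qed
    ultimately consider "r * p = 0" | "r * p = p" using min by blast
    then show "r \<in> V"
      by cases (auto simp: V_def intro: exI[of _ 0] exI[of _ 1] simp: scaleC_one)
  qed
  ultimately have "N \<subseteq> V" by (intro projections_total[OF N(1)])
  then show ?thesis using c by (auto simp: V_def)
qed

lemma minimal_projections_orthogonal:
  assumes N: "von_neumann_algebra N" "abelian N"
    and p: "minimal_projection N p" and q: "minimal_projection N q" and "p \<noteq> q"
  shows "p * q = 0"
proof -
  have pp: "p \<in> N" "p * p = p" "star p = p" "p \<noteq> 0" and qq: "q \<in> N" "q * q = q" "star q = q" "q \<noteq> 0"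
    using p q by (auto simp: minimal_projection_def projections_def)
  have pq: "p * q = q * p" using N(2) pp qq by (simp add: abelian_def)
  have "p * (p * q) = p * p * q" by (simp only: mult.assoc)
  moreover have "q * (p * q) = p * (q * q)" by (simp only: mult.assoc[symmetric] pq[symmetric])
  ultimately have ppq: "p * (p * q) = p * q" "q * (p * q) = p * q" by (simp_all only: pp qq)
  have "p * q * (p * q) = p * (q * (p * q))" by (simp only: mult.assoc)
  then have "p * q \<in> projections N"
    using vna_mult[OF N(1) pp(1) qq(1)] pp qq by (simp add: projections_def star_mult ppq pq[symmetric])
  then have "p * q = 0 \<or> p * q = p" "p * q = 0 \<or> p * q = q"
    using p q ppq by (auto simp: minimal_projection_def subprojection_def)
  then show ?thesis using \<open>p \<noteq> q\<close> by auto
qed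

lemma vn_normalizer_inverse_conj:
  assumes u: "u \<in> vn_normalizer M N"
  shows "star u * (u * x * star u) * u = x" "u * (star u * x * u) * star u = x"
proof -
  have u': "star u * u = 1" "u * star u = 1" using u by (auto simp: vn_normalizer_def unitaries_def)
  have "star u * (u * x * star u) * u = (star u * u) * x * (star u * u)" by (simp only: mult.assoc)
  then show "star u * (u * x * star u) * u = x" by (simp add: u')
  have "u * (star u * x * u) * star u = (u * star u) * x * (u * star u)" by (simp only: mult.assoc)
  then show "u * (star u * x * u) * star u = x" by (simp add: u')
qed

lemma vn_normalizer_conj:
  assumes "u \<in> vn_normalizer M N" "n \<in> N"
  shows "u * n * star u \<in> N"
  using assms by (auto simp: vn_normalizer_def)

lemma vn_normalizer_conj_mult:
  assumes u: "u \<in> vn_normalizer M N"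
  shows "u * x * star u * (u * y * star u) = u * (x * y) * star u"
proof -
  have "star u * u = 1" using u by (auto simp: vn_normalizer_def unitaries_def)
  moreover have "u * x * star u * (u * y * star u) = u * x * (star u * u) * y * star u" by (simp only: mult.assoc)
  ultimately show ?thesis by (simp add: mult.assoc)
qed

text \<open>Conjugation by \<open>u\<close> is an automorphism of \<open>N\<close>.\<close>

lemma minimal_projection_conj:
  assumes M: "von_neumann_algebra M" and u: "u \<in> vn_normalizer M N" and p: "minimal_projection N p"
  shows "minimal_projection N (u * p * star u)"
proof -
  have u': "star u \<in> vn_normalizer M N" by (rule vn_normalizer_star[OF M u])
  have pp: "p \<in> N" "p * p = p" "star p = p" "p \<noteq> 0"
    and min: "\<And>q. q \<in> projections N \<Longrightarrow> p * q = q \<Longrightarrow> q = 0 \<or> q = p"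
    using p by (auto simp: minimal_projection_def projections_def subprojection_def)
  note inv = vn_normalizer_inverse_conj[OF u]
  have "star (u * p * star u) = u * p * star u" by (simp add: star_mult star_star pp mult.assoc)
  then have "u * p * star u \<in> projections N"
    using vn_normalizer_conj[OF u pp(1)]
    by (simp add: projections_def vn_normalizer_conj_mult[OF u] pp(2))
  moreover have "u * p * star u \<noteq> 0" using inv(1)[of p] pp(4) by auto
  moreover have "q = 0 \<or> q = u * p * star u"
    if q: "q \<in> projections N" "u * p * star u * q = q" for q
  proof -
    define r where "r = star u * q * u"
    have qr: "q = u * r * star u" by (simp add: r_def inv)
    have q': "q \<in> N" "q * q = q" "star q = q" using q(1) by (auto simp: projections_def)
    have "r \<in> N" "r * r = r" "star r = r"
      using vn_normalizer_conj[OF u' q'(1)] vn_normalizer_conj_mult[OF u', of q q]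
      by (simp_all add: r_def star_star star_mult q' mult.assoc)
    then have "r \<in> projections N" by (simp add: projections_def)
    moreover have "p * r = r"
    proof -
      have "u * (p * r) * star u = u * r * star u"
        using q(2) vn_normalizer_conj_mult[OF u, of p r] by (simp add: qr[symmetric])
      then show ?thesis using inv(1)[of "p * r"] inv(1)[of r] by simp
    qed
    ultimately have "r = 0 \<or> r = p" by (rule min)
    then show ?thesis using qr by auto
  qed
  ultimately show ?thesis by (auto simp: minimal_projection_def subprojection_def)
qed

lemma vn_normalizer_mult:
  assumes M: "von_neumann_algebra M" and u: "u \<in> vn_normalizer M N" "w \<in> vn_normalizer M N"
  shows "u * w \<in> vn_normalizer M N"
proof -
  have u': "u \<in> M" "star u * u = 1" "u * star u = 1" "(\<lambda>x. u * x * star u) ` N = N"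
    and w': "w \<in> M" "star w * w = 1" "w * star w = 1" "(\<lambda>x. w * x * star w) ` N = N"
    using u by (auto simp: vn_normalizer_def unitaries_def)
  have "star (u * w) * (u * w) = star w * (star u * u) * w" "u * w * star (u * w) = u * (w * star w) * star u"
    by (simp_all only: star_mult mult.assoc)
  then have "u * w \<in> unitaries M" using vna_mult[OF M] u' w' by (simp add: unitaries_def)
  moreover have "(\<lambda>x. u * w * x * star (u * w)) ` N = (\<lambda>x. u * x * star u) ` (\<lambda>x. w * x * star w) ` N"
    by (simp add: image_image star_mult mult.assoc)
  then have "(\<lambda>x. u * w * x * star (u * w)) ` N = N" by (simp only: u' w')
  ultimately show ?thesis by (simp add: vn_normalizer_def)
qed

lemma vn_normalizer_one: "von_neumann_algebra M \<Longrightarrow> 1 \<in> vn_normalizer M N"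
  by (simp add: vn_normalizer_def unitaries_def vna_one)

text \<open>The normalizer permutes the minimal projections of \<open>N\<close>. The orbit of one of them consists of orthogonal
  equivalent projections, so it is finite because \<open>M\<close> is. Its sum commutes with the normalizer, which by
  regularity generates \<open>M\<close>; so the sum is central in a factor and equals \<open>1\<close>. Thus \<open>N\<close> is spanned by the
  orbit.\<close>

lemma diffuse_or_finite_dimensional:
  fixes M :: "'h::chilbert_space bop set"
  assumes M: "vn_factor M" "finite_vna M" and N: "von_neumann_algebra N" "abelian N" "N \<subseteq> M"
    and reg: "vn_regular M N"
  shows "diffuse N \<or> finite_dimensional N"
proof (cases "\<exists>p. minimal_projection N p")
  case False
  then show ?thesis using N by (simp add: diffuse_def)
next
  case True
  then obtain p where p: "minimal_projection N p" by blast
  have vM: "von_neumann_algebra M" using M(2) by (simp add: finite_vna_def)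
  have pp: "p \<in> N" "p * p = p" "star p = p" "p \<noteq> 0"
    using p by (auto simp: minimal_projection_def projections_def)
  let ?G = "vn_normalizer M N"
  define Orb where "Orb = (\<lambda>u. u * p * star u) ` ?G"
  have Omin: "minimal_projection N e" if "e \<in> Orb" for e
    using that minimal_projection_conj[OF vM _ p] by (auto simp: Orb_def)
  have ON: "Orb \<subseteq> N" using Omin by (auto simp: minimal_projection_def projections_def)
  have Oorth: "a * b = 0" if "a \<in> Orb" "b \<in> Orb" "a \<noteq> b" for a b
    using minimal_projections_orthogonal[OF N(1,2) Omin Omin] that by blast
  have fin: "finite Orb"
  proof (rule ccontr)
    assume "infinite Orb"
    then obtain f :: "nat \<Rightarrow> 'h bop" where f: "inj f" "range f \<subseteq> Orb"
      using infinite_countable_subset by blast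
    then have "\<forall>i. \<exists>u\<in>?G. f i = u * p * star u" by (auto simp: Orb_def image_subset_iff)
    then obtain u where u: "\<And>i. u i \<in> ?G" "\<And>i. f i = u i * p * star (u i)" by metis
    have "p = 0"
    proof (rule finite_vna_no_infinite_orbit[OF M(2)])
      show "p \<in> projections M" using pp N(3) by (auto simp: projections_def)
      show "u i \<in> unitaries M" for i using u(1)[of i] by (simp add: vn_normalizer_def)
      show "u i * p * star (u i) * (u j * p * star (u j)) = 0" if "i \<noteq> j" for i j
        unfolding u(2)[symmetric]
      proof (rule Oorth)
        show "f i \<noteq> f j" using f(1) that by (simp add: inj_eq)
      qed (use f(2) in blast)+
    qed
    with pp(4) show False by simp
  qed
  define q where "q = (\<Sum>e\<in>Orb. e)"
  have Nsub: "complex_vector.subspace N"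
    using N(1) by (simp add: von_neumann_algebra_def star_subalgebra_def)
  have "q \<in> N" unfolding q_def using ON by (intro complex_vector.subspace_sum[OF Nsub]) auto
  have "q \<in> commutant ?G"
  proof (rule commutantI)
    fix u assume u: "u \<in> ?G"
    note inv = vn_normalizer_inverse_conj[OF u]
    have us: "star u \<in> ?G" by (rule vn_normalizer_star[OF vM u])
    have stable: "w * e * star w \<in> Orb" if w: "w \<in> ?G" and e: "e \<in> Orb" for w e
    proof -
      obtain v where v: "v \<in> ?G" "e = v * p * star v" using e by (auto simp: Orb_def)
      have "w * e * star w = (w * v) * p * star (w * v)" by (simp add: v star_mult mult.assoc)
      then show ?thesis using vn_normalizer_mult[OF vM w v(1)] by (auto simp: Orb_def)
    qed
    have "u * q * star u = (\<Sum>e\<in>Orb. u * e * star u)"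
      by (simp add: q_def sum_distrib_left sum_distrib_right)
    also have "\<dots> = q" unfolding q_def
      by (rule sum.reindex_bij_witness[where i = "\<lambda>e. star u * e * u" and j = "\<lambda>e. u * e * star u"])
        (use inv stable[OF u] stable[OF us] in \<open>auto simp: star_star\<close>)
    finally have "u * q * star u * u = q * u" by simp
    then show "q * u = u * q" using u by (simp add: mult.assoc vn_normalizer_def unitaries_def)
  qed
  also have "commutant ?G = commutant M"
    using reg commutant_bicommutant[of ?G] by (simp add: vn_regular_def)
  finally have "q \<in> vn_center M" using \<open>q \<in> N\<close> N(3) by (auto simp: vn_center_def)
  then obtain l where l: "q = l *\<^sub>C 1" using M(1) by (auto simp: vn_factor_def)
  have pO: "p \<in> Orb" unfolding Orb_def
    by (rule image_eqI[of _ _ 1]) (simp_all add: vn_normalizer_one[OF vM])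
  have "q * p = (\<Sum>e\<in>Orb. if e = p then p else 0)"
    unfolding q_def sum_distrib_right by (rule sum.cong) (auto simp: pp Oorth pO)
  also have "\<dots> = p" using fin pO by simp
  finally have "l *\<^sub>C p = 1 *\<^sub>C p" by (simp add: l mult_scaleC_left scaleC_one)
  then have "l = 1" using complex_vector.scale_cancel_right[of l p 1] pp(4) by blast
  then have q1: "q = 1" by (simp add: l scaleC_one)
  have "N \<subseteq> complex_vector.span Orb"
  proof
    fix n assume n: "n \<in> N"
    have "n = (\<Sum>e\<in>Orb. n * e)" using q1 by (simp add: q_def sum_distrib_left[symmetric])
    also have "\<dots> \<in> complex_vector.span Orb"
    proof (rule complex_vector.span_sum)
      fix e assume e: "e \<in> Orb"
      obtain m where "n * e = m *\<^sub>C e"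
        using minimal_projection_scalar[OF N(1,2) Omin[OF e] n] by blast
      then show "n * e \<in> complex_vector.span Orb"
        using e by (simp add: complex_vector.span_base complex_vector.span_scale)
    qed
    finally show "n \<in> complex_vector.span Orb" .
  qed
  moreover have "complex_vector.span Orb \<subseteq> N"
    by (rule complex_vector.span_minimal[OF ON Nsub])
  ultimately show ?thesis using fin unfolding finite_dimensional_def by blast
qed

theorem proposition2p2:
  fixes C :: "'a::cstar_algebra set"
    and \<pi> :: "'a \<Rightarrow> 'h::chilbert_space bop"
  assumes "star_subalgebra C" and "C \<noteq> {0}" and "abelian C" and "cstar_regular C"
    and "star_hom \<pi>"
    and "finite_vna (bicommutant (range \<pi>))"
  shows "vn_regular (bicommutant (range \<pi>)) (bicommutant (\<pi> ` C)) \<and>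
    (type_II1_factor (bicommutant (range \<pi>)) \<longrightarrow>
      diffuse (bicommutant (\<pi> ` C)) \<or> finite_dimensional (bicommutant (\<pi> ` C)))"
proof (intro conjI impI)
  show reg: "vn_regular (bicommutant (range \<pi>)) (bicommutant (\<pi> ` C))"
    using assms by (intro vn_regular_bicommutant_image)
  assume "type_II1_factor (bicommutant (range \<pi>))"
  then have factor: "vn_factor (bicommutant (range \<pi>))" by (simp add: type_II1_factor_def)
  have "star_subalgebra (\<pi> ` C)" using assms by (intro star_hom_image)
  then have N: "von_neumann_algebra (bicommutant (\<pi> ` C))"
    by (intro von_neumann_algebra_bicommutant) (simp only: star_subalgebra_def)
  have "\<pi> x * \<pi> y = \<pi> (x * y)" for x y using assms(5) by (simp add: star_hom_def)
  then have "abelian (\<pi> ` C)" using assms(3) by (auto simp: abelian_def)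
  then have "abelian (bicommutant (\<pi> ` C))" by (rule abelian_bicommutant)
  moreover have "bicommutant (\<pi> ` C) \<subseteq> bicommutant (range \<pi>)" by (rule bicommutant_mono) auto
  ultimately show "diffuse (bicommutant (\<pi> ` C)) \<or> finite_dimensional (bicommutant (\<pi> ` C))"
    using diffuse_or_finite_dimensional[OF factor assms(6) N _ _ reg] by blast
qed

end
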